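(* Let $Z=(Z(t))_{t\in T}$ be a zero-mean (real-valued) Gaussian process on an index set $T$ such that for every $s_0\in T$ the conditional distribution of $(Z(t))_{t\in T}$ given that $Z(s_0)=0$ coincides with the distribution of $(\varphi(t;s_0)Z(t))_{t\in T}$ for some function $\varphi(\cdot\,;s_0):T\to\mathbb{R}$. Then there is a disjoint decomposition $T=\bigcup_{\alpha\in I}T_\alpha$ and a function $a:T\to\mathbb{R}$ such that the following hold: (i) $(Z(t))_{t\in T_\alpha}$ is independent of $(Z(t))_{t\in T_\beta}$ for all $\alpha\neq\beta$; (ii) for each $\alpha\in I$, either there is a function $\psi_\alpha:T_\alpha\to\mathbb{R}$ such that $$(Z(t))_{t\in T_\alpha}\overset{\mathrm{f.d.d.}}{=}(a(t)X(\psi_\alpha(t)))_{t\in T_\alpha},$$ or there are an admissible pair $(x,y)$ and a function $\psi_\alpha:T_\alpha\to\{A,B,C,D\}$ such that $$(Z(t))_{t\in T_\alpha}\overset{\mathrm{f.d.d.}}{=}(a(t)Y_{x,y}(\psi_\alpha(t)))_{t\in T_\alpha}.$$ Here $(X(s))_{s\in\mathbb{R}}$ is the zero-mean Gaussian process with $\mathbb{E}[X(s)X(t)]=\frac1{\cosh(t-s)}$ for $s,t\in\mathbb{R}$, and $Y_{x,y}=(Y_{x,y}(s))_{s\in\{A,B,C,D\}}$ is the zero-mean, unit-variance Gaussian process on the four-point index set $\{A,B,C,D\}$ with (writing $Y=Y_{x,y}$) $$\mathbb{E}[Y(A)Y(B)]=\mathbb{E}[Y(C)Y(D)]=\frac1{\cosh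 x},\quad \mathbb{E}[Y(A)Y(D)]=\mathbb{E}[Y(B)Y(C)]=\frac1{\cosh y},\quad \mathbb{E}[Y(A)Y(C)]=\mathbb{E}[Y(B)Y(D)]=\frac1{\cosh(x-y)}.$$
   Context: A pair $(x,y)$ is admissible if $x>0$, $y>0$, $x\neq y$, and the $4\times4$ symmetric matrix indexed by $A,B,C,D$ with unit diagonal and off-diagonal entries $(A,B)=(C,D)=1/\cosh x$, $(A,D)=(B,C)=1/\cosh y$, $(A,C)=(B,D)=1/\cosh(x-y)$ is positive semi-definite. $\overset{\mathrm{f.d.d.}}{=}$ denotes equality of all finite-dimensional distributions; the distribution of a process is understood as its family of finite-dimensional distributions. The conditional distribution of the zero-mean Gaussian process $Z$ given $Z(s_0)=0$ is understood in the usual Gaussian sense: if $\operatorname{Var}Z(s_0)>0$ it is the law of $\left(Z(t)-\frac{\operatorname{Cov}(Z(t),Z(s_0))}{\operatorname{Var}Z(s_0)}Z(s_0)\right)_{t\in T}$, and if $\operatorname{Var}Z(s_0)=0$ it is the law of $Z$ itself. *)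

theory Defs
  imports "HOL-Probability.Probability"
begin

(* Constants are Gaussian: the second disjunct is the normal law with variance 0. *)
definition gaussian_rv :: "'w measure \<Rightarrow> ('w \<Rightarrow> real) \<Rightarrow> bool" where
  "gaussian_rv M X \<longleftrightarrow> X \<in> borel_measurable M \<and>
     (\<exists>\<mu> \<sigma>. (0 < \<sigma> \<and> distributed M lborel X (normal_density \<mu> \<sigma>)) \<or> (AE \<omega> in M. X \<omega> = \<mu>))"

definition gaussian_process :: "'w measure \<Rightarrow> 't set \<Rightarrow> ('t \<Rightarrow> 'w \<Rightarrow> real) \<Rightarrow> bool" where
  "gaussian_process M T Z \<longleftrightarrow> prob_space M \<and>
     (\<forall>F c. finite F \<and> F \<subseteq> T \<longrightarrow> gaussian_rv M (\<lambda>\<omega>. \<Sum>t\<in>F. c t * Z t \<omega>))"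

definition centred_gaussian_process :: "'w measure \<Rightarrow> 't set \<Rightarrow> ('t \<Rightarrow> 'w \<Rightarrow> real) \<Rightarrow> bool" where
  "centred_gaussian_process M T Z \<longleftrightarrow>
     gaussian_process M T Z \<and> (\<forall>t\<in>T. (\<integral>\<omega>. Z t \<omega> \<partial>M) = 0)"

definition cov :: "'w measure \<Rightarrow> ('w \<Rightarrow> real) \<Rightarrow> ('w \<Rightarrow> real) \<Rightarrow> real" where
  "cov M U V = (\<integral>\<omega>. (U \<omega> - (\<integral>\<omega>'. U \<omega>' \<partial>M)) * (V \<omega> - (\<integral>\<omega>'. V \<omega>' \<partial>M)) \<partial>M)"

(* The two processes may live on different probability spaces. *)
definition same_fdd ::
  "'t set \<Rightarrow> 'w measure \<Rightarrow> ('t \<Rightarrow> 'w \<Rightarrow> real) \<Rightarrow> 'v measure \<Rightarrow> ('t \<Rightarrow> 'v \<Rightarrow> real) \<Rightarrow> bool" where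
  "same_fdd T M U N V \<longleftrightarrow> (\<forall>J. finite J \<and> J \<subseteq> T \<longrightarrow>
     distr M (PiM J (\<lambda>_. borel)) (\<lambda>\<omega>. \<lambda>t\<in>J. U t \<omega>) =
     distr N (PiM J (\<lambda>_. borel)) (\<lambda>\<omega>. \<lambda>t\<in>J. V t \<omega>))"

(* A process whose law is the conditional law of the centred Gaussian process Z given Z s = 0. *)
definition conditioned_at_zero ::
  "'w measure \<Rightarrow> ('t \<Rightarrow> 'w \<Rightarrow> real) \<Rightarrow> 't \<Rightarrow> 't \<Rightarrow> 'w \<Rightarrow> real" where
  "conditioned_at_zero M Z s = (\<lambda>t \<omega>.
     if cov M (Z s) (Z s) > 0
     then Z t \<omega> - cov M (Z t) (Z s) / cov M (Z s) (Z s) * Z s \<omega>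
     else Z t \<omega>)"

(* The law, on the product space, of the centred Gaussian process with covariance kernel K,
   realised as the coordinate process.  For positive semi-definite K it exists and is unique,
   so the choice made by SOME is immaterial; both kernels below are positive semi-definite
   (the second one for admissible parameters). *)
definition centred_gaussian_law :: "('i \<Rightarrow> 'i \<Rightarrow> real) \<Rightarrow> ('i \<Rightarrow> real) measure" where
  "centred_gaussian_law K = (SOME \<mu>.
     sets \<mu> = sets (PiM UNIV (\<lambda>_. borel)) \<and>
     centred_gaussian_process \<mu> UNIV (\<lambda>s \<omega>. \<omega> s) \<and>
     (\<forall>s t. (\<integral>\<omega>. \<omega> s * \<omega> t \<partial>\<mu>) = K s t))"

definition X_law :: "(real \<Rightarrow> real) measure" where
  "X_law = centred_gaussian_law (\<lambda>s t. 1 / cosh (t - s))"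

definition X_proc :: "real \<Rightarrow> (real \<Rightarrow> real) \<Rightarrow> real" where
  "X_proc s \<omega> = \<omega> s"

(* The index set {A, B, C, D}. *)
datatype four = PA | PB | PC | PD

instance four :: finite
proof
  have "(UNIV :: four set) = {PA, PB, PC, PD}"
    using four.exhaust by auto
  then show "finite (UNIV :: four set)" by (metis finite.emptyI finite.insertI)
qed

definition Y_cov :: "real \<Rightarrow> real \<Rightarrow> four \<Rightarrow> four \<Rightarrow> real" where
  "Y_cov x y i j =
     (if i = j then 1
      else if {i, j} = {PA, PB} \<or> {i, j} = {PC, PD} then 1 / cosh x
      else if {i, j} = {PA, PD} \<or> {i, j} = {PB, PC} then 1 / cosh y
      else 1 / cosh (x - y))"

definition pos_semidef :: "('i::finite \<Rightarrow> 'i \<Rightarrow> real) \<Rightarrow> bool" where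
  "pos_semidef K \<longleftrightarrow> (\<forall>i j. K i j = K j i) \<and>
     (\<forall>c. 0 \<le> (\<Sum>i\<in>UNIV. \<Sum>j\<in>UNIV. c i * K i j * c j))"

definition admissible :: "real \<Rightarrow> real \<Rightarrow> bool" where
  "admissible x y \<longleftrightarrow> 0 < x \<and> 0 < y \<and> x \<noteq> y \<and> pos_semidef (Y_cov x y)"

definition Y_law :: "real \<Rightarrow> real \<Rightarrow> (four \<Rightarrow> real) measure" where
  "Y_law x y = centred_gaussian_law (Y_cov x y)"

definition Y_proc :: "four \<Rightarrow> (four \<Rightarrow> real) \<Rightarrow> real" where
  "Y_proc s \<omega> = \<omega> s"

end

theory Submission
  imports Defs
begin

text \<open>Comparing covariances, the hypothesis says that the kernel \<open>K\<close> of \<open>Z\<close> satisfies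
  \<open>K t u - K t s * K u s / K s s = \<phi> t * \<phi> u * K t u\<close>. Hence being correlated is an
  equivalence relation, and within a class the signs of the correlations factor, so that up to signs
  the correlation of \<open>t\<close> and \<open>u\<close> is \<open>1 / cosh (d t u)\<close>. Taking \<open>t = u\<close> gives
  \<open>\<bar>\<phi> t\<bar> = tanh (d t s)\<close>, and the equation becomes the addition theorem
  \<open>cosh (d t u) = cosh (d t s \<plusminus> d u s)\<close>: every triangle for \<open>d\<close> is degenerate. By
  Menger's theorem such a pseudometric either embeds in the line, which yields \<open>X\<close>, or consists
  of four points with equal opposite sides, which yields \<open>Y\<close>. Gaussian laws are recovered from
  their covariances by a uniqueness theorem for finite-dimensional characteristic functions.\<close>

section \<open>Uniqueness of finite-dimensional laws\<close>

text \<open>Conditioning controls \<phi> only through its squares: taking \<open>t = u\<close> fixes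
  \<open>\<bar>\<phi> t\<bar>\<close>, while the sign of \<open>\<phi> t * \<phi> u\<close> stays
  open. This open sign is the choice between sum and difference in the addition theorem, and so the
  source of the four-point exception. Inside a class all correlations are nonzero, hence
  \<open>\<bar>\<phi> t\<bar> < 1\<close> and \<open>1 - \<phi> t * \<phi> u\<close> is positive.
  The equation therefore splits into one for moduli, which becomes geometry, and one for signs,
  which \<open>a\<close> absorbs. A time of zero variance is a class by itself, with
  \<open>a = 0\<close> there. Both target laws are chosen by \<open>SOME\<close>, so nothing is
  known about them until some process with the right kernel is exhibited. For X this is an explicit
  random series. For Y nothing is constructed: the four-point alternative arises only when all four
  vertices are occupied, so that \<open>Z\<close>, rescaled at one time per vertex, is itself the
  witness. The same process shows that the parameters are admissible.\<close>

lemma (in prob_space) integrable_mult_iexp: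
  assumes [measurable]: "g \<in> borel_measurable M" "X \<in> borel_measurable M"
    and "\<And>\<omega>. \<bar>g \<omega>\<bar> \<le> (B::real)"
  shows "integrable M (\<lambda>\<omega>. complex_of_real (g \<omega>) * iexp (X \<omega>))"
  by (rule integrable_const_bound[where B=B]) (auto simp: norm_mult assms)

text \<open>Dividing by the common mean \<open>C\<close> turns both weights into probability
  densities. Under the tilted measures \<open>X\<close> and \<open>Y\<close> have equal
  characteristic functions, so Levy's theorem identifies their laws.\<close>

lemma weighted_distr_eq_of_char_eq:
  fixes X :: "'a \<Rightarrow> real" and Y :: "'b \<Rightarrow> real"
  assumes "prob_space M" "prob_space N"
    and X[measurable]: "X \<in> borel_measurable M" and Y[measurable]: "Y \<in> borel_measurable N"
    and g[measurable]: "g \<in> borel_measurable M" and h[measurable]: "h \<in> borel_measurable N"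
    and g_ge: "\<And>\<omega>. 1 \<le> g \<omega>" and h_ge: "\<And>\<omega>. 1 \<le> h \<omega>"
    and g_le: "\<And>\<omega>. g \<omega> \<le> B" and h_le: "\<And>\<omega>. h \<omega> \<le> B"
    and ch: "\<And>s. (CLINT \<omega>|M. complex_of_real (g \<omega>) * iexp (s * X \<omega>)) =
                  (CLINT \<omega>|N. complex_of_real (h \<omega>) * iexp (s * Y \<omega>))"
    and A[measurable]: "A \<in> sets borel"
  shows "(\<integral>\<omega>. g \<omega> * indicator A (X \<omega>) \<partial>M) = (\<integral>\<omega>. h \<omega> * indicator A (Y \<omega>) \<partial>N)"
proof -
  interpret M: prob_space M by fact
  interpret N: prob_space N by fact
  have g_abs: "\<bar>g \<omega>\<bar> \<le> B" and h_abs: "\<bar>h \<omega>'\<bar> \<le> B" for \<omega> \<omega>'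
    using g_ge[of \<omega>] g_le[of \<omega>] h_ge[of \<omega>'] h_le[of \<omega>'] by auto
  have ig: "integrable M g"
    by (rule M.integrable_const_bound[where B=B]) (auto simp: g_abs)
  have ih: "integrable N h"
    by (rule N.integrable_const_bound[where B=B]) (auto simp: h_abs)
  define C where "C = (\<integral>\<omega>. g \<omega> \<partial>M)"
  \<comment> \<open>Frequency 0 in \<open>ch\<close> shows that the two weights have the same mean,
    so one constant normalises both.\<close>
  have C': "C = (\<integral>\<omega>. h \<omega> \<partial>N)"
    using ch[of 0] unfolding C_def by (simp add: integral_complex_of_real)
  have C1: "1 \<le> C"
    unfolding C_def using integral_mono[of M "\<lambda>_. 1" g] ig g_ge by (auto simp: M.prob_space)
  have *: "prob_space (density K (\<lambda>\<omega>. ennreal (w \<omega> / C)))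
      \<and> (\<forall>s. char (distr (density K (\<lambda>\<omega>. ennreal (w \<omega> / C))) borel V) s
           = (CLINT \<omega>|K. complex_of_real (w \<omega>) * iexp (s * V \<omega>)) / C)
      \<and> measure (distr (density K (\<lambda>\<omega>. ennreal (w \<omega> / C))) borel V) A
           = (\<integral>\<omega>. w \<omega> * indicator A (V \<omega>) \<partial>K) / C"
    if "prob_space K" and [measurable]: "w \<in> borel_measurable K" "V \<in> borel_measurable K"
      and iw: "integrable K w" and w1: "\<And>\<omega>. 1 \<le> w \<omega>" and wC: "C = (\<integral>\<omega>. w \<omega> \<partial>K)" for K :: "'k measure" and w V
  proof (intro conjI allI)
    interpret K: prob_space K by fact
    have w0: "0 \<le> w \<omega>" for \<omega> using w1[of \<omega>] by simp
    let ?D = "density K (\<lambda>\<omega>. ennreal (w \<omega> / C))"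
    show ps: "prob_space ?D"
    proof
      have "emeasure ?D (space ?D) = (\<integral>\<^sup>+\<omega>. ennreal (w \<omega> / C) \<partial>K)"
        by (subst emeasure_density) (auto intro!: nn_integral_cong)
      also have "\<dots> = ennreal (\<integral>\<omega>. w \<omega> / C \<partial>K)"
        using iw w0 C1 by (intro nn_integral_eq_integral) auto
      also have "\<dots> = 1" using C1 wC by simp
      finally show "emeasure ?D (space ?D) = 1" .
    qed
    interpret D: prob_space ?D by (rule ps)
    show "char (distr ?D borel V) s = (CLINT \<omega>|K. complex_of_real (w \<omega>) * iexp (s * V \<omega>)) / C" for s
    proof -
      have "char (distr ?D borel V) s = (CLINT \<omega>|?D. iexp (s * V \<omega>))"
        unfolding char_def by (subst integral_distr) auto
      also have "\<dots> = (CLINT \<omega>|K. (w \<omega> / C) *\<^sub>R iexp (s * V \<omega>))"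
        using w0 C1 by (subst integral_density) auto
      also have "\<dots> = (CLINT \<omega>|K. complex_of_real (w \<omega>) * iexp (s * V \<omega>) / C)"
        by (simp add: scaleR_conv_of_real)
      finally show ?thesis by simp
    qed
    have "measure (distr ?D borel V) A = measure ?D (V -` A \<inter> space K)"
      by (subst measure_distr) auto
    also have "\<dots> = (\<integral>\<omega>. indicator (V -` A \<inter> space K) \<omega> \<partial>?D)"
      by simp
    also have "\<dots> = (\<integral>\<omega>. (w \<omega> / C) * indicator (V -` A \<inter> space K) \<omega> \<partial>K)"
      using w0 C1 by (subst integral_density) auto
    also have "\<dots> = (\<integral>\<omega>. w \<omega> * indicator A (V \<omega>) / C \<partial>K)"
      by (intro Bochner_Integration.integral_cong) (auto split: split_indicator)
    finally show "measure (distr ?D borel V) A = (\<integral>\<omega>. w \<omega> * indicator A (V \<omega>) \<partial>K) / C" by simp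
  qed
  note m = *[OF \<open>prob_space M\<close> g X ig g_ge C_def]
  note n = *[OF \<open>prob_space N\<close> h Y ih h_ge C']
  have "distr (density M (\<lambda>\<omega>. ennreal (g \<omega> / C))) borel X = distr (density N (\<lambda>\<omega>. ennreal (h \<omega> / C))) borel Y"
    using m n ch by (intro Levy_uniqueness) (auto intro!: prob_space.real_distribution_distr ext)
  then show ?thesis
    using m n C1 by (auto simp: divide_simps)
qed

text \<open>Extends the positive case to signed weights such as cosines and sines: it is applied to
  the constant weight and to a shifted \<open>g\<close>, and the results are subtracted. The
  unweighted hypothesis \<open>chX\<close> accounts for the shift.\<close>

lemma expectation_mult_indicator_eq:
  fixes X :: "'a \<Rightarrow> real" and Y :: "'b \<Rightarrow> real"
  assumes "prob_space M" "prob_space N"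
    and X[measurable]: "X \<in> borel_measurable M" and Y[measurable]: "Y \<in> borel_measurable N"
    and g[measurable]: "g \<in> borel_measurable M" and h[measurable]: "h \<in> borel_measurable N"
    and g_le: "\<And>\<omega>. \<bar>g \<omega>\<bar> \<le> 1" and h_le: "\<And>\<omega>. \<bar>h \<omega>\<bar> \<le> 1"
    and chX: "\<And>s. (CLINT \<omega>|M. iexp (s * X \<omega>)) = (CLINT \<omega>|N. iexp (s * Y \<omega>))"
    and ch: "\<And>s. (CLINT \<omega>|M. complex_of_real (g \<omega>) * iexp (s * X \<omega>)) =
                  (CLINT \<omega>|N. complex_of_real (h \<omega>) * iexp (s * Y \<omega>))"
    and A[measurable]: "A \<in> sets borel"
  shows "(\<integral>\<omega>. g \<omega> * indicator A (X \<omega>) \<partial>M) = (\<integral>\<omega>. h \<omega> * indicator A (Y \<omega>) \<partial>N)"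
proof -
  interpret M: prob_space M by fact
  interpret N: prob_space N by fact
  \<comment> \<open>Adding \<open>2\<close> makes the weight positive, so that it can be normalised to a density.\<close>
  have b: "1 \<le> 2 + g \<omega>" "2 + g \<omega> \<le> 3" "1 \<le> 2 + h \<omega>'" "2 + h \<omega>' \<le> 3" for \<omega> \<omega>'
    using g_le[of \<omega>] h_le[of \<omega>'] by auto
  have "(\<integral>\<omega>. (1::real) * indicator A (X \<omega>) \<partial>M) = (\<integral>\<omega>. 1 * indicator A (Y \<omega>) \<partial>N)"
    by (rule weighted_distr_eq_of_char_eq[where B=1]) (use chX in \<open>auto intro!: assms(1,2)\<close>)
  moreover have "(\<integral>\<omega>. (2 + g \<omega>) * indicator A (X \<omega>) \<partial>M) = (\<integral>\<omega>. (2 + h \<omega>) * indicator A (Y \<omega>) \<partial>N)"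
  proof (rule weighted_distr_eq_of_char_eq[where B=3])
    fix s
    have "(CLINT \<omega>|M. complex_of_real (2 + g \<omega>) * iexp (s * X \<omega>)) =
       2 * (CLINT \<omega>|M. iexp (s * X \<omega>)) + (CLINT \<omega>|M. complex_of_real (g \<omega>) * iexp (s * X \<omega>))"
      by (simp add: ring_distribs M.integrable_iexp M.integrable_mult_iexp[where g=g and X="\<lambda>\<omega>. s * X \<omega>" and B=1, simplified] g_le)
    moreover have "(CLINT \<omega>|N. complex_of_real (2 + h \<omega>) * iexp (s * Y \<omega>)) =
       2 * (CLINT \<omega>|N. iexp (s * Y \<omega>)) + (CLINT \<omega>|N. complex_of_real (h \<omega>) * iexp (s * Y \<omega>))"
      by (simp add: ring_distribs N.integrable_iexp N.integrable_mult_iexp[where g=h and X="\<lambda>\<omega>. s * Y \<omega>" and B=1, simplified] h_le)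
    ultimately show "(CLINT \<omega>|M. complex_of_real (2 + g \<omega>) * iexp (s * X \<omega>)) =
      (CLINT \<omega>|N. complex_of_real (2 + h \<omega>) * iexp (s * Y \<omega>))"
      using chX ch by simp
  qed (use b in \<open>auto intro!: assms(1,2)\<close>)
  moreover have "integrable M (\<lambda>\<omega>. indicator A (X \<omega>) :: real)" "integrable N (\<lambda>\<omega>. indicator A (Y \<omega>) :: real)"
    by (auto intro!: M.integrable_const_bound[where B=1] N.integrable_const_bound[where B=1])
  moreover have "integrable M (\<lambda>\<omega>. g \<omega> * indicator A (X \<omega>) :: real)"
    "integrable N (\<lambda>\<omega>. h \<omega> * indicator A (Y \<omega>) :: real)"
    by (auto intro!: M.integrable_const_bound[where B=1] N.integrable_const_bound[where B=1] AE_I2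
        simp: g_le h_le split: split_indicator)
  ultimately show ?thesis by (simp add: ring_distribs)
qed

text \<open>The weights above are real, so a frozen exponential must be split into cosine and sine.
  Euler's formula, here and in the sine version below, turns such a weight back into exponentials,
  about which the induction hypothesis speaks.\<close>

lemma of_real_cos_mult_iexp:
  "complex_of_real (cos b) * iexp x = (iexp (b + x) + iexp (- b + x)) / 2"
  by (simp add: complex_eq_iff Re_exp Im_exp cos_add sin_add cos_diff sin_diff minus_real_def[symmetric] field_simps)

lemma of_real_sin_mult_iexp:
  "complex_of_real (sin b) * iexp x = (iexp (b + x) - iexp (- b + x)) / (2 * \<i>)"
  by (simp add: complex_eq_iff Re_exp Im_exp cos_add sin_add cos_diff sin_diff minus_real_def[symmetric] Re_divide Im_divide power2_eq_square field_simps)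

text \<open>The exponentials in the joint characteristic function are traded one coordinate at a time
  for indicators: with the other coordinates frozen into a bounded weight, each trade is Levy's
  one-dimensional uniqueness theorem.\<close>

lemma expectation_prod_indicator_iexp_eq:
  fixes U :: "'t \<Rightarrow> 'a \<Rightarrow> real" and V :: "'t \<Rightarrow> 'b \<Rightarrow> real"
  assumes pM: "prob_space M" and pN: "prob_space N" and J: "finite J"
    and U[measurable]: "\<And>t. t \<in> J \<Longrightarrow> U t \<in> borel_measurable M"
    and V[measurable]: "\<And>t. t \<in> J \<Longrightarrow> V t \<in> borel_measurable N"
    and ch: "\<And>c. (CLINT \<omega>|M. iexp (\<Sum>t\<in>J. c t * U t \<omega>)) = (CLINT \<omega>|N. iexp (\<Sum>t\<in>J. c t * V t \<omega>))"
    and F: "F \<subseteq> J" and A: "\<And>t. A t \<in> sets (borel::real measure)"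
  shows "(CLINT \<omega>|M. complex_of_real (\<Prod>t\<in>F. indicator (A t) (U t \<omega>)) * iexp (\<Sum>t\<in>J-F. c t * U t \<omega>)) =
         (CLINT \<omega>|N. complex_of_real (\<Prod>t\<in>F. indicator (A t) (V t \<omega>)) * iexp (\<Sum>t\<in>J-F. c t * V t \<omega>))"
  using finite_subset[OF F J] F
proof (induction F arbitrary: c rule: finite_induct)
  case empty
  then show ?case using ch by simp
next
  case (insert t F)
  interpret M: prob_space M by fact
  interpret N: prob_space N by fact
  note A[measurable]
  have t: "t \<in> J" "t \<notin> F" and FJ: "F \<subseteq> J" and "finite F" using insert by auto
  have UF[measurable]: "(\<lambda>\<omega>. (\<Prod>t\<in>F. indicator (A t) (U t \<omega>)) :: real) \<in> borel_measurable M"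
    by (intro borel_measurable_prod borel_measurable_indicator') (use FJ in auto)
  have VF[measurable]: "(\<lambda>\<omega>. (\<Prod>t\<in>F. indicator (A t) (V t \<omega>)) :: real) \<in> borel_measurable N"
    by (intro borel_measurable_prod borel_measurable_indicator') (use FJ in auto)
  have [measurable]: "U t \<in> borel_measurable M" "V t \<in> borel_measurable N" using t by auto
  define a where "a \<omega> = (\<Sum>t\<in>J-insert t F. c t * U t \<omega>)" for \<omega>
  define b where "b \<omega> = (\<Sum>t\<in>J-insert t F. c t * V t \<omega>)" for \<omega>
  have [measurable]: "a \<in> borel_measurable M" "b \<in> borel_measurable N"
    unfolding a_def b_def by measurable
  define p where "p \<omega> = (\<Prod>t\<in>F. indicator (A t) (U t \<omega>) :: real)" for \<omega>
  define q where "q \<omega> = (\<Prod>t\<in>F. indicator (A t) (V t \<omega>) :: real)" for \<omega>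
  have [measurable]: "p \<in> borel_measurable M" "q \<in> borel_measurable N"
    unfolding p_def q_def by measurable
  have "0 \<le> p \<omega>" "p \<omega> \<le> 1" "0 \<le> q \<omega>'" "q \<omega>' \<le> 1" for \<omega> \<omega>'
    unfolding p_def q_def by (auto intro!: prod_nonneg prod_le_1 simp: indicator_le_1)
  then have pq: "\<bar>p \<omega>\<bar> \<le> 1" "\<bar>q \<omega>'\<bar> \<le> 1" for \<omega> \<omega>' by simp_all
  have JF: "J - F = insert t (J - insert t F)" "t \<notin> J - insert t F" "finite (J - insert t F)" using t J by auto
  have k1: "(CLINT \<omega>|M. complex_of_real (p \<omega>) * iexp (a \<omega> + s * U t \<omega>)) =
            (CLINT \<omega>|N. complex_of_real (q \<omega>) * iexp (b \<omega> + s * V t \<omega>))" for s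
  proof -
    have "(\<Sum>u\<in>J-F. (c(t:=s)) u * U u \<omega>) = a \<omega> + s * U t \<omega>" for \<omega>
      unfolding JF(1) a_def by (subst sum.insert) (use JF(2,3) in \<open>auto intro!: sum.cong\<close>)
    moreover have "(\<Sum>u\<in>J-F. (c(t:=s)) u * V u \<omega>) = b \<omega> + s * V t \<omega>" for \<omega>
      unfolding JF(1) b_def by (subst sum.insert) (use JF(2,3) in \<open>auto intro!: sum.cong\<close>)
    ultimately show ?thesis using insert.IH[OF FJ, of "c(t:=s)"] by (simp add: p_def q_def)
  qed
  have k2: "(CLINT \<omega>|M. complex_of_real (p \<omega>) * iexp (- a \<omega> + s * U t \<omega>)) =
            (CLINT \<omega>|N. complex_of_real (q \<omega>) * iexp (- b \<omega> + s * V t \<omega>))" for s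
  proof -
    have "(\<Sum>u\<in>J-F. ((\<lambda>x. - c x)(t:=s)) u * U u \<omega>) = - a \<omega> + s * U t \<omega>" for \<omega>
      unfolding JF(1) a_def sum_negf[symmetric] by (subst sum.insert) (use JF(2,3) in \<open>auto intro!: sum.cong\<close>)
    moreover have "(\<Sum>u\<in>J-F. ((\<lambda>x. - c x)(t:=s)) u * V u \<omega>) = - b \<omega> + s * V t \<omega>" for \<omega>
      unfolding JF(1) b_def sum_negf[symmetric] by (subst sum.insert) (use JF(2,3) in \<open>auto intro!: sum.cong\<close>)
    ultimately show ?thesis using insert.IH[OF FJ, of "(\<lambda>x. - c x)(t:=s)"] by (simp add: p_def q_def)
  qed
  \<comment> \<open>The marginal law of the coordinate being traded, from \<open>ch\<close> with all
    other coefficients 0; it supplies \<open>chX\<close>.\<close>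
  have one: "(CLINT \<omega>|M. iexp (s * U t \<omega>)) = (CLINT \<omega>|N. iexp (s * V t \<omega>))" for s
  proof -
    have "(\<Sum>u\<in>J. ((\<lambda>x. 0)(t:=s)) u * f u) = s * f t" for f
      using t J by (subst sum.remove[of J t]) (auto intro!: sum.neutral)
    then show ?thesis using ch[of "(\<lambda>x. 0)(t:=s)"] by simp
  qed
  have iM: "integrable M (\<lambda>\<omega>. complex_of_real (p \<omega>) * iexp (v \<omega>))" if "v \<in> borel_measurable M" for v
    using that pq by (intro M.integrable_mult_iexp[where B=1]) auto
  have iN: "integrable N (\<lambda>\<omega>. complex_of_real (q \<omega>) * iexp (v \<omega>))" if "v \<in> borel_measurable N" for v
    using that pq by (intro N.integrable_mult_iexp[where B=1]) auto
  have le1: "\<bar>x * y\<bar> \<le> 1" if "\<bar>x\<bar> \<le> 1" "\<bar>y\<bar> \<le> 1" for x y :: real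
    using that by (simp add: abs_mult mult_le_one)
  have c: "(\<integral>\<omega>. (p \<omega> * cos (a \<omega>)) * indicator (A t) (U t \<omega>) \<partial>M) = (\<integral>\<omega>. (q \<omega> * cos (b \<omega>)) * indicator (A t) (V t \<omega>) \<partial>N)"
  proof (rule expectation_mult_indicator_eq[OF pM pN])
    fix s
    have *: "complex_of_real (x * cos y) * iexp z = (complex_of_real x * iexp (y + z) + complex_of_real x * iexp (- y + z)) / 2" for x y z
      unfolding of_real_mult mult.assoc of_real_cos_mult_iexp by (simp only: times_divide_eq_right ring_distribs)
    show "(CLINT \<omega>|M. complex_of_real (p \<omega> * cos (a \<omega>)) * iexp (s * U t \<omega>)) =
          (CLINT \<omega>|N. complex_of_real (q \<omega> * cos (b \<omega>)) * iexp (s * V t \<omega>))"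
      unfolding * by (simp only: integral_divide_zero Bochner_Integration.integral_add iM iN k1 k2
          borel_measurable_add borel_measurable_uminus borel_measurable_times borel_measurable_const
          \<open>a \<in> borel_measurable M\<close> \<open>b \<in> borel_measurable N\<close> \<open>U t \<in> borel_measurable M\<close> \<open>V t \<in> borel_measurable N\<close>)
  qed (use one in \<open>auto intro!: le1 pq\<close>)
  have s: "(\<integral>\<omega>. (p \<omega> * sin (a \<omega>)) * indicator (A t) (U t \<omega>) \<partial>M) = (\<integral>\<omega>. (q \<omega> * sin (b \<omega>)) * indicator (A t) (V t \<omega>) \<partial>N)"
  proof (rule expectation_mult_indicator_eq[OF pM pN])
    fix s
    have *: "complex_of_real (x * sin y) * iexp z = (complex_of_real x * iexp (y + z) - complex_of_real x * iexp (- y + z)) / (2 * \<i>)" for x y z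
      unfolding of_real_mult mult.assoc of_real_sin_mult_iexp by (simp only: times_divide_eq_right ring_distribs)
    show "(CLINT \<omega>|M. complex_of_real (p \<omega> * sin (a \<omega>)) * iexp (s * U t \<omega>)) =
          (CLINT \<omega>|N. complex_of_real (q \<omega> * sin (b \<omega>)) * iexp (s * V t \<omega>))"
      unfolding * by (simp only: integral_divide_zero Bochner_Integration.integral_diff iM iN k1 k2
          borel_measurable_add borel_measurable_uminus borel_measurable_times borel_measurable_const
          \<open>a \<in> borel_measurable M\<close> \<open>b \<in> borel_measurable N\<close> \<open>U t \<in> borel_measurable M\<close> \<open>V t \<in> borel_measurable N\<close>)
  qed (use one in \<open>auto intro!: le1 pq\<close>)
  \<comment> \<open>The coordinate \<open>t\<close> now enters through an indicator, and the phase
    left over is reassembled from the cosine and sine parts settled in \<open>c\<close> and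
    \<open>s\<close>.\<close>
  have e: "complex_of_real (\<Prod>u\<in>insert t F. indicator (A u) (f u)) * iexp y =
       complex_of_real ((\<Prod>u\<in>F. indicator (A u) (f u)) * cos y * indicator (A t) (f t)) +
       \<i> * complex_of_real ((\<Prod>u\<in>F. indicator (A u) (f u)) * sin y * indicator (A t) (f t))" for f y
    using t \<open>finite F\<close> by (simp add: complex_eq_iff Re_exp Im_exp)
  have 1: "integrable M (\<lambda>\<omega>. p \<omega> * f (a \<omega>) * indicator (A t) (U t \<omega>))"
    "integrable N (\<lambda>\<omega>. q \<omega> * f (b \<omega>) * indicator (A t) (V t \<omega>))" if "f = cos \<or> f = sin" for f :: "real \<Rightarrow> real"
    using that by (auto intro!: M.integrable_const_bound[where B=1] N.integrable_const_bound[where B=1] AE_I2 le1 pq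
        simp del: mult_1_right split: split_indicator)
  show ?case
    unfolding e a_def[symmetric] b_def[symmetric] p_def[symmetric] q_def[symmetric]
    by (simp only: Bochner_Integration.integral_add integrable_of_real integrable_mult_right 1 simp_thms
       integral_mult_right_zero integral_complex_of_real c s)
qed

text \<open>Once every coordinate has been traded, the characteristic function has become the
  probability of a box, and boxes determine a finite measure on a finite product.\<close>

lemma distr_PiM_eq_of_char_eq:
  fixes U :: "'t \<Rightarrow> 'a \<Rightarrow> real" and V :: "'t \<Rightarrow> 'b \<Rightarrow> real"
  assumes pM: "prob_space M" and pN: "prob_space N" and J: "finite J"
    and U[measurable]: "\<And>t. t \<in> J \<Longrightarrow> U t \<in> borel_measurable M"
    and V[measurable]: "\<And>t. t \<in> J \<Longrightarrow> V t \<in> borel_measurable N"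
    and ch: "\<And>c. (CLINT \<omega>|M. iexp (\<Sum>t\<in>J. c t * U t \<omega>)) = (CLINT \<omega>|N. iexp (\<Sum>t\<in>J. c t * V t \<omega>))"
  shows "distr M (PiM J (\<lambda>_. borel)) (\<lambda>\<omega>. \<lambda>t\<in>J. U t \<omega>) = distr N (PiM J (\<lambda>_. borel)) (\<lambda>\<omega>. \<lambda>t\<in>J. V t \<omega>)"
proof -
  interpret M: prob_space M by fact
  interpret N: prob_space N by fact
  have mU: "(\<lambda>\<omega>. \<lambda>t\<in>J. U t \<omega>) \<in> M \<rightarrow>\<^sub>M PiM J (\<lambda>_. borel)"
    and mV: "(\<lambda>\<omega>. \<lambda>t\<in>J. V t \<omega>) \<in> N \<rightarrow>\<^sub>M PiM J (\<lambda>_. borel)" by (auto intro!: measurable_restrict)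
  have key: "emeasure (distr K (PiM J (\<lambda>_. borel)) (\<lambda>\<omega>. \<lambda>t\<in>J. W t \<omega>)) (PiE J A)
     = ennreal (\<integral>\<omega>. (\<Prod>t\<in>J. indicator (A t) (W t \<omega>)) \<partial>K)"
    if "prob_space K" and W: "\<And>t. t \<in> J \<Longrightarrow> W t \<in> borel_measurable K" and A: "\<And>t. t \<in> J \<Longrightarrow> A t \<in> sets (borel :: real measure)"
    for K :: "'k measure" and W A
  proof -
    interpret K: prob_space K by fact
    have m: "(\<lambda>\<omega>. \<lambda>t\<in>J. W t \<omega>) \<in> K \<rightarrow>\<^sub>M PiM J (\<lambda>_. borel)" using W by (auto intro!: measurable_restrict)
    have s: "PiE J A \<in> sets (PiM J (\<lambda>_. borel))" using A J by (intro sets_PiM_I_finite) auto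
    have "emeasure (distr K (PiM J (\<lambda>_. borel)) (\<lambda>\<omega>. \<lambda>t\<in>J. W t \<omega>)) (PiE J A) =
      emeasure K ((\<lambda>\<omega>. \<lambda>t\<in>J. W t \<omega>) -` PiE J A \<inter> space K)" using m s by (simp add: emeasure_distr)
    also have "\<dots> = ennreal (\<integral>\<omega>. indicator ((\<lambda>\<omega>. \<lambda>t\<in>J. W t \<omega>) -` PiE J A \<inter> space K) \<omega> \<partial>K)"
      using measurable_sets[OF m s] by (simp add: K.emeasure_eq_measure)
    also have "(\<integral>\<omega>. (indicator ((\<lambda>\<omega>. \<lambda>t\<in>J. W t \<omega>) -` PiE J A \<inter> space K) \<omega> :: real) \<partial>K) = (\<integral>\<omega>. (\<Prod>t\<in>J. indicator (A t) (W t \<omega>)) \<partial>K)"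
    proof (intro Bochner_Integration.integral_cong refl)
      fix \<omega> assume "\<omega> \<in> space K"
      then show "indicator ((\<lambda>\<omega>. \<lambda>t\<in>J. W t \<omega>) -` PiE J A \<inter> space K) \<omega> = (\<Prod>t\<in>J. indicator (A t) (W t \<omega>) :: real)"
        using J by (auto simp: indicator_def PiE_iff intro!: prod.neutral[symmetric] prod_zero[symmetric])
    qed
    finally show ?thesis .
  qed
  show ?thesis
  proof (rule measure_eqI_PiM_finite[OF J])
    fix A :: "'t \<Rightarrow> real set" assume A: "\<And>i. i \<in> J \<Longrightarrow> A i \<in> sets borel"
    \<comment> \<open>The trading lemma wants measurable sets at every index, so \<open>A\<close> is
      replaced by the empty set outside \<open>J\<close>; the box over \<open>J\<close> is
      unchanged.\<close>
    define B where "B t = (if t \<in> J then A t else {})" for t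
    have "(CLINT \<omega>|M. complex_of_real (\<Prod>t\<in>J. indicator (B t) (U t \<omega>)) * iexp (\<Sum>t\<in>J-J. 0 * U t \<omega>)) =
         (CLINT \<omega>|N. complex_of_real (\<Prod>t\<in>J. indicator (B t) (V t \<omega>)) * iexp (\<Sum>t\<in>J-J. 0 * V t \<omega>))"
      by (rule expectation_prod_indicator_iexp_eq[OF pM pN J U V ch]) (use A in \<open>auto simp: B_def\<close>)
    then have "(\<integral>\<omega>. (\<Prod>t\<in>J. indicator (B t) (U t \<omega>) :: real) \<partial>M) = (\<integral>\<omega>. (\<Prod>t\<in>J. indicator (B t) (V t \<omega>)) \<partial>N)"
      by (simp add: integral_complex_of_real del: of_real_prod)
    moreover have "PiE J A = PiE J B" by (auto simp: B_def PiE_iff)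
    ultimately show "emeasure (distr M (Pi\<^sub>M J (\<lambda>_. borel)) (\<lambda>\<omega>. \<lambda>t\<in>J. U t \<omega>)) (Pi\<^sub>E J A) =
         emeasure (distr N (Pi\<^sub>M J (\<lambda>_. borel)) (\<lambda>\<omega>. \<lambda>t\<in>J. V t \<omega>)) (Pi\<^sub>E J A)"
      using key[OF pM, of U B] key[OF pN, of V B] U V A by (simp add: B_def)
  next
    show "range (\<lambda>_::nat. space (PiM J (\<lambda>_. borel :: real measure))) \<subseteq> prod_algebra J (\<lambda>_. borel)"
      using prod_algebraI_finite[OF J, of "\<lambda>_. UNIV" "\<lambda>_. borel"] by (auto simp: space_PiM)
    show "(\<Union>i. space (PiM J (\<lambda>_. borel :: real measure))) = space (PiM J (\<lambda>_. borel))" by simp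
    show "emeasure (distr M (Pi\<^sub>M J (\<lambda>_. borel)) (\<lambda>\<omega>. \<lambda>t\<in>J. U t \<omega>)) (space (PiM J (\<lambda>_. borel))) \<noteq> \<infinity>" for i :: nat
      using M.prob_space_distr[OF mU] by (metis prob_space.emeasure_space_1 space_distr ennreal_one_neq_top infinity_ennreal_def)
  qed auto
qed

section \<open>Centred Gaussian processes and their covariances\<close>

lemma (in prob_space) integrable_mult_of_square_integrable:
  fixes X Y :: "'a \<Rightarrow> real"
  assumes [measurable]: "X \<in> borel_measurable M" "Y \<in> borel_measurable M"
    and "integrable M (\<lambda>\<omega>. (X \<omega>)\<^sup>2)" "integrable M (\<lambda>\<omega>. (Y \<omega>)\<^sup>2)"
  shows "integrable M (\<lambda>\<omega>. X \<omega> * Y \<omega>)"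
proof (rule Bochner_Integration.integrable_bound)
  show "integrable M (\<lambda>\<omega>. (X \<omega>)\<^sup>2 + (Y \<omega>)\<^sup>2)" using assms by auto
  have "\<bar>x * y\<bar> \<le> x\<^sup>2 + y\<^sup>2" for x y :: real
  proof -
    have "0 \<le> (\<bar>x\<bar> - \<bar>y\<bar>)\<^sup>2 + x\<^sup>2 + y\<^sup>2" by simp
    then show ?thesis by (simp add: power2_diff abs_mult)
  qed
  then show "AE \<omega> in M. norm (X \<omega> * Y \<omega>) \<le> norm ((X \<omega>)\<^sup>2 + (Y \<omega>)\<^sup>2)"
    by (intro AE_I2) simp
qed simp

lemma (in prob_space) std_normal_distributed_facts:
  assumes "distributed M lborel Y std_normal_density"
  shows "integrable M Y" "integrable M (\<lambda>\<omega>. (Y \<omega>)\<^sup>2)"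
    "(\<integral>\<omega>. Y \<omega> \<partial>M) = 0" "(\<integral>\<omega>. (Y \<omega>)\<^sup>2 \<partial>M) = 1"
    "(CLINT \<omega>|M. iexp (s * Y \<omega>)) = exp (- (s\<^sup>2) / 2)"
proof -
  have Y[measurable]: "Y \<in> borel_measurable M" using distributed_measurable[OF assms] by simp
  have d: "distr M lborel Y = std_normal_distribution"
    using distributed_distr_eq_density[OF assms] .
  note D = d[symmetric]
  show "integrable M Y"
    using integrable_std_normal_distribution_moment[of 1] unfolding D by (subst (asm) integrable_distr_eq) auto
  show "integrable M (\<lambda>\<omega>. (Y \<omega>)\<^sup>2)"
    using integrable_std_normal_distribution_moment[of 2] unfolding D by (subst (asm) integrable_distr_eq) auto
  show "(\<integral>\<omega>. Y \<omega> \<partial>M) = 0"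
  proof -
    have "(\<integral>x. x ^ 1 \<partial>std_normal_distribution) = 0"
      by (rule integral_std_normal_distribution_moment_odd) simp
    then show ?thesis unfolding D by (subst (asm) integral_distr) auto
  qed
  show "(\<integral>\<omega>. (Y \<omega>)\<^sup>2 \<partial>M) = 1"
    using std_normal_distribution_even_moments(1)[of 1] unfolding D by (subst (asm) integral_distr) (auto simp: numeral_2_eq_2)
  show "(CLINT \<omega>|M. iexp (s * Y \<omega>)) = exp (- (s\<^sup>2) / 2)"
    using fun_cong[OF char_std_normal_distribution, of s] unfolding D char_def by (subst (asm) integral_distr) auto
qed

lemma gaussian_rv_square_integrable:
  assumes "prob_space M" "gaussian_rv M X"
  shows "X \<in> borel_measurable M" "integrable M X" "integrable M (\<lambda>\<omega>. (X \<omega>)\<^sup>2)"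
proof -
  interpret prob_space M by fact
  show X[measurable]: "X \<in> borel_measurable M" using assms unfolding gaussian_rv_def by auto
  consider \<mu> \<sigma> where "0 < \<sigma>" "distributed M lborel X (normal_density \<mu> \<sigma>)" | \<mu> where "AE \<omega> in M. X \<omega> = \<mu>"
    using assms unfolding gaussian_rv_def by auto
  then show "integrable M (\<lambda>\<omega>. (X \<omega>)\<^sup>2)"
  proof cases
    case 1
    define Y where "Y \<omega> = (X \<omega> - \<mu>) / \<sigma>" for \<omega>
    have "distributed M lborel Y std_normal_density"
      using 1 normal_standard_normal_convert[of \<sigma> X \<mu>] unfolding Y_def by auto
    note Y = std_normal_distributed_facts[OF this]
    have "X = (\<lambda>\<omega>. \<mu> + \<sigma> * Y \<omega>)" using 1 by (auto simp: Y_def)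
    then show ?thesis using Y by (simp add: power2_sum power_mult_distrib)
  next
    case 2
    then have "AE \<omega> in M. (X \<omega>)\<^sup>2 = \<mu>\<^sup>2" by auto
    then show ?thesis by (subst integrable_cong_AE[where g="\<lambda>_. \<mu>\<^sup>2"]) auto
  qed
  then show "integrable M X" by (rule square_integrable_imp_integrable[OF X])
qed

lemma gaussian_rv_char:
  assumes "prob_space M" "gaussian_rv M X" and mean: "(\<integral>\<omega>. X \<omega> \<partial>M) = 0"
  shows "(CLINT \<omega>|M. iexp (X \<omega>)) = exp (- (\<integral>\<omega>. (X \<omega>)\<^sup>2 \<partial>M) / 2)"
proof -
  interpret prob_space M by fact
  have X[measurable]: "X \<in> borel_measurable M" using assms unfolding gaussian_rv_def by auto
  consider \<mu> \<sigma> where "0 < \<sigma>" "distributed M lborel X (normal_density \<mu> \<sigma>)" | \<mu> where "AE \<omega> in M. X \<omega> = \<mu>"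
    using assms unfolding gaussian_rv_def by auto
  then show ?thesis
  proof cases
    case 1
    define Y where "Y \<omega> = (X \<omega> - \<mu>) / \<sigma>" for \<omega>
    have "distributed M lborel Y std_normal_density"
      using 1 normal_standard_normal_convert[of \<sigma> X \<mu>] unfolding Y_def by auto
    note Y = std_normal_distributed_facts[OF this]
    have "\<mu> = 0" using normal_distributed_expectation[OF 1(1,2)] mean by simp
    then have X_eq: "X = (\<lambda>\<omega>. \<sigma> * Y \<omega>)" using 1 by (auto simp: Y_def)
    show ?thesis unfolding X_eq using Y(4) Y(5)[of \<sigma>] by (simp add: power_mult_distrib)
  next
    case 2
    have "(\<integral>\<omega>. X \<omega> \<partial>M) = (\<integral>\<omega>. \<mu> \<partial>M)" using 2 by (intro integral_cong_AE) auto
    then have "\<mu> = 0" using mean by (simp add: prob_space)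
    then have "(CLINT \<omega>|M. iexp (X \<omega>)) = (CLINT \<omega>|M. 1)"
      using 2 by (intro integral_cong_AE) auto
    moreover have "(\<integral>\<omega>. (X \<omega>)\<^sup>2 \<partial>M) = (\<integral>\<omega>. 0 \<partial>M)"
      using 2 \<open>\<mu> = 0\<close> by (intro integral_cong_AE) auto
    ultimately show ?thesis by (simp add: prob_space)
  qed
qed

text \<open>Converse of \<open>gaussian_rv_char\<close>, for variables whose Gaussianity has to be
  produced, namely series limits and coordinates of image laws. The case \<open>v = 0\<close> is the
  Dirac mass at 0, the other is the standard normal after scaling.\<close>

lemma gaussian_rv_of_char:
  assumes "prob_space M" and X[measurable]: "X \<in> borel_measurable M"
    and ch: "\<And>s. (CLINT \<omega>|M. iexp (s * X \<omega>)) = exp (- (s\<^sup>2 * v) / 2)"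
  shows "gaussian_rv M X" "(\<integral>\<omega>. X \<omega> \<partial>M) = 0" "(\<integral>\<omega>. (X \<omega>)\<^sup>2 \<partial>M) = v"
proof -
  interpret prob_space M by fact
  \<comment> \<open>A characteristic function is bounded by 1, which forces the sign of
    \<open>v\<close>.\<close>
  have "cmod (CLINT \<omega>|M. iexp (X \<omega>)) \<le> (\<integral>\<omega>. 1 \<partial>M)"
    by (rule order_trans[OF integral_norm_bound]) simp
  then have "v \<ge> 0" using ch[of 1] by (simp add: prob_space norm_exp_eq_Re)
  then consider "v = 0" | "v > 0" by linarith
  then have "gaussian_rv M X \<and> (\<integral>\<omega>. X \<omega> \<partial>M) = 0 \<and> (\<integral>\<omega>. (X \<omega>)\<^sup>2 \<partial>M) = v"
  proof cases
    case 1
    have "distr M borel X = distr M borel (\<lambda>_. 0)"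
    proof (rule Levy_uniqueness)
      show "char (distr M borel X) = char (distr M borel (\<lambda>_. 0))"
        using ch 1 by (simp add: char_def integral_distr prob_space fun_eq_iff del: distr_const)
    qed (intro real_distribution_distr; simp)+
    then have "emeasure (distr M borel X) {0} = 1"
      by (simp add: emeasure_return)
    then have "emeasure M (X -` {0} \<inter> space M) = 1"
      by (simp add: emeasure_distr)
    then have "AE \<omega> in M. \<omega> \<in> X -` {0} \<inter> space M"
      by (intro AE_prob_1) (simp add: emeasure_eq_measure)
    then have X0: "AE \<omega> in M. X \<omega> = 0" by auto
    then have "(\<integral>\<omega>. X \<omega> \<partial>M) = (\<integral>\<omega>. 0 \<partial>M)"
      by (intro integral_cong_AE) auto
    moreover have "(\<integral>\<omega>. (X \<omega>)\<^sup>2 \<partial>M) = (\<integral>\<omega>. 0 \<partial>M)"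
      using X0 by (intro integral_cong_AE) auto
    ultimately show ?thesis using X0 1 unfolding gaussian_rv_def by auto
  next
    case 2
    define \<sigma> where "\<sigma> = sqrt v"
    have \<sigma>: "\<sigma> > 0" "\<sigma>\<^sup>2 = v" using 2 by (auto simp: \<sigma>_def)
    have "distr M borel (\<lambda>\<omega>. X \<omega> / \<sigma>) = std_normal_distribution"
    proof (rule Levy_uniqueness)
      show "char (distr M borel (\<lambda>\<omega>. X \<omega> / \<sigma>)) = char std_normal_distribution"
      proof
        fix t
        show "char (distr M borel (\<lambda>\<omega>. X \<omega> / \<sigma>)) t = char std_normal_distribution t"
          using ch[of "t / \<sigma>"] \<sigma> 2 fun_cong[OF char_std_normal_distribution, of t]
          by (simp add: char_def integral_distr power_divide)
      qed
    qed (auto simp: real_dist_normal_dist)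
    then have "distr M lborel (\<lambda>\<omega>. X \<omega> / \<sigma>) = std_normal_distribution"
      by (simp cong: distr_cong)
    then have "distributed M lborel (\<lambda>\<omega>. (X \<omega> - 0) / \<sigma>) std_normal_density"
      unfolding distributed_def by auto
    then have d: "distributed M lborel X (normal_density 0 \<sigma>)"
      using normal_standard_normal_convert[of \<sigma> X 0] \<sigma> by auto
    show ?thesis
      using d normal_distributed_expectation[OF \<sigma>(1) d] normal_distributed_variance[OF \<sigma>(1) d] \<sigma>
      unfolding gaussian_rv_def by auto
  qed
  then show "gaussian_rv M X" "(\<integral>\<omega>. X \<omega> \<partial>M) = 0" "(\<integral>\<omega>. (X \<omega>)\<^sup>2 \<partial>M) = v" by auto
qed

lemma centred_gaussian_process_gaussian_rv:
  assumes "centred_gaussian_process M T Z" "finite F" "F \<subseteq> T"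
  shows "gaussian_rv M (\<lambda>\<omega>. \<Sum>t\<in>F. c t * Z t \<omega>)"
  using assms unfolding centred_gaussian_process_def gaussian_process_def by simp

lemma centred_gaussian_processD:
  assumes "centred_gaussian_process M T Z"
  shows "prob_space M" "\<And>t. t \<in> T \<Longrightarrow> Z t \<in> borel_measurable M" "\<And>t. t \<in> T \<Longrightarrow> integrable M (Z t)"
    "\<And>t. t \<in> T \<Longrightarrow> (\<integral>\<omega>. Z t \<omega> \<partial>M) = 0"
    "\<And>s t. s \<in> T \<Longrightarrow> t \<in> T \<Longrightarrow> integrable M (\<lambda>\<omega>. Z s \<omega> * Z t \<omega>)"
proof -
  show M: "prob_space M" using assms unfolding centred_gaussian_process_def gaussian_process_def by auto
  interpret prob_space M by fact
  have g: "gaussian_rv M (Z t)" if "t \<in> T" for t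
    using centred_gaussian_process_gaussian_rv[OF assms, of "{t}" "\<lambda>_. 1"] that by simp
  note sq = gaussian_rv_square_integrable[OF M g]
  show "Z t \<in> borel_measurable M" "integrable M (Z t)" if "t \<in> T" for t using sq that by auto
  show "integrable M (\<lambda>\<omega>. Z s \<omega> * Z t \<omega>)" if "s \<in> T" "t \<in> T" for s t
    by (intro integrable_mult_of_square_integrable sq that)
  show "(\<integral>\<omega>. Z t \<omega> \<partial>M) = 0" if "t \<in> T" for t
    using that assms unfolding centred_gaussian_process_def by auto
qed

lemma centred_gaussian_process_char:
  assumes Z: "centred_gaussian_process M T Z" and F: "finite F" "F \<subseteq> T"
  shows "(CLINT \<omega>|M. iexp (\<Sum>t\<in>F. c t * Z t \<omega>)) =
    exp (- (\<Sum>s\<in>F. \<Sum>t\<in>F. c s * c t * (\<integral>\<omega>. Z s \<omega> * Z t \<omega> \<partial>M)) / 2)"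
proof -
  note D = centred_gaussian_processD[OF Z]
  interpret prob_space M by (rule D(1))
  have g: "gaussian_rv M (\<lambda>\<omega>. \<Sum>t\<in>F. c t * Z t \<omega>)"
    by (rule centred_gaussian_process_gaussian_rv[OF Z F])
  have i: "integrable M (Z t)" if "t \<in> F" for t using that D(3) F(2) by blast
  have p: "integrable M (\<lambda>\<omega>. Z s \<omega> * Z t \<omega>)" if "s \<in> F" "t \<in> F" for s t using that D(5) F(2) by blast
  have m: "(\<integral>\<omega>. (\<Sum>t\<in>F. c t * Z t \<omega>) \<partial>M) = 0"
    using i D(4) F by (subst Bochner_Integration.integral_sum) (auto intro!: sum.neutral)
  have "(\<integral>\<omega>. (\<Sum>t\<in>F. c t * Z t \<omega>)\<^sup>2 \<partial>M) = (\<integral>\<omega>. (\<Sum>s\<in>F. \<Sum>t\<in>F. c s * c t * (Z s \<omega> * Z t \<omega>)) \<partial>M)"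
    by (simp add: power2_eq_square sum_product ac_simps)
  also have "\<dots> = (\<Sum>s\<in>F. \<Sum>t\<in>F. c s * c t * (\<integral>\<omega>. Z s \<omega> * Z t \<omega> \<partial>M))"
    by (simp add: Bochner_Integration.integral_sum Bochner_Integration.integrable_sum p)
  finally show ?thesis using gaussian_rv_char[OF D(1) g m] by simp
qed

text \<open>The joint characteristic function contains that of each linear combination, by scaling
  the coefficients. The variances so obtained give the covariances by polarisation, which uses the
  symmetry of \<open>K\<close>.\<close>

lemma centred_gaussian_process_of_char:
  assumes "prob_space M" and Z[measurable]: "\<And>t. t \<in> T \<Longrightarrow> Z t \<in> borel_measurable M"
    and K_sym: "\<And>s t. s \<in> T \<Longrightarrow> t \<in> T \<Longrightarrow> K s t = K t s"
    and ch: "\<And>F c. finite F \<Longrightarrow> F \<subseteq> T \<Longrightarrow>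
      (CLINT \<omega>|M. iexp (\<Sum>t\<in>F. c t * Z t \<omega>)) = exp (- (\<Sum>s\<in>F. \<Sum>t\<in>F. c s * c t * K s t) / 2)"
  shows "centred_gaussian_process M T Z" "\<And>s t. s \<in> T \<Longrightarrow> t \<in> T \<Longrightarrow> (\<integral>\<omega>. Z s \<omega> * Z t \<omega> \<partial>M) = K s t"
proof -
  interpret prob_space M by fact
  have meas: "(\<lambda>\<omega>. \<Sum>t\<in>F. c t * Z t \<omega>) \<in> borel_measurable M" if "F \<subseteq> T" for F c
    using that by (intro borel_measurable_sum borel_measurable_times) auto
  have ch': "(CLINT \<omega>|M. iexp (r * (\<Sum>t\<in>F. c t * Z t \<omega>))) = exp (- (r\<^sup>2 * (\<Sum>s\<in>F. \<Sum>t\<in>F. c s * c t * K s t)) / 2)"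
    if "finite F" "F \<subseteq> T" for F c r
    using ch[OF that, of "\<lambda>t. r * c t"] by (simp only: sum_distrib_left power2_eq_square ac_simps)
  have g: "gaussian_rv M (\<lambda>\<omega>. \<Sum>t\<in>F. c t * Z t \<omega>)" "(\<integral>\<omega>. (\<Sum>t\<in>F. c t * Z t \<omega>) \<partial>M) = 0"
    "(\<integral>\<omega>. (\<Sum>t\<in>F. c t * Z t \<omega>)\<^sup>2 \<partial>M) = (\<Sum>s\<in>F. \<Sum>t\<in>F. c s * c t * K s t)"
    if "finite F" "F \<subseteq> T" for F c
    by (rule gaussian_rv_of_char[OF prob_space_axioms meas[OF that(2)] ch'[OF that]])+
  have g1: "(\<integral>\<omega>. Z t \<omega> \<partial>M) = 0" "(\<integral>\<omega>. (Z t \<omega>)\<^sup>2 \<partial>M) = K t t" if "t \<in> T" for t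
    using g(2,3)[of "{t}" "\<lambda>_. 1"] that by auto
  show cg: "centred_gaussian_process M T Z"
    unfolding centred_gaussian_process_def gaussian_process_def
    using g(1) g1(1) prob_space_axioms by auto
  note D = centred_gaussian_processD[OF cg]
  fix s t assume st: "s \<in> T" "t \<in> T"
  show "(\<integral>\<omega>. Z s \<omega> * Z t \<omega> \<partial>M) = K s t"
  proof (cases "s = t")
    case True
    then show ?thesis using g1(2) st by (simp add: power2_eq_square)
  next
    case False
    \<comment> \<open>Polarisation: the variance of \<open>Z s + Z t\<close> contains twice the
      mixed moment.\<close>
    have "(\<integral>\<omega>. (\<Sum>u\<in>{s,t}. 1 * Z u \<omega>)\<^sup>2 \<partial>M) = (\<Sum>u\<in>{s,t}. \<Sum>v\<in>{s,t}. 1 * 1 * K u v)"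
      using st by (intro g(3)) auto
    then have "(\<integral>\<omega>. (Z s \<omega>)\<^sup>2 + (Z t \<omega>)\<^sup>2 + 2 * (Z s \<omega> * Z t \<omega>) \<partial>M) = K s s + K t t + 2 * K s t"
      using False K_sym st by (simp add: power2_sum mult.assoc)
    moreover have "(\<integral>\<omega>. (Z s \<omega>)\<^sup>2 + (Z t \<omega>)\<^sup>2 + 2 * (Z s \<omega> * Z t \<omega>) \<partial>M) =
      (\<integral>\<omega>. (Z s \<omega>)\<^sup>2 \<partial>M) + (\<integral>\<omega>. (Z t \<omega>)\<^sup>2 \<partial>M) + 2 * (\<integral>\<omega>. Z s \<omega> * Z t \<omega> \<partial>M)"
      using D(5) st by (simp add: power2_eq_square)
    ultimately show ?thesis using g1 st by simp
  qed
qed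

lemma same_fdd_of_covariance:
  assumes U: "centred_gaussian_process M S U" and V: "centred_gaussian_process N S V"
    and eq: "\<And>s t. s \<in> S \<Longrightarrow> t \<in> S \<Longrightarrow> (\<integral>\<omega>. U s \<omega> * U t \<omega> \<partial>M) = (\<integral>\<omega>. V s \<omega> * V t \<omega> \<partial>N)"
  shows "same_fdd S M U N V"
  unfolding same_fdd_def
proof (intro allI impI, elim conjE)
  fix J assume J: "finite J" "J \<subseteq> S"
  have "(\<Sum>s\<in>J. \<Sum>t\<in>J. c s * c t * (\<integral>\<omega>. U s \<omega> * U t \<omega> \<partial>M)) = (\<Sum>s\<in>J. \<Sum>t\<in>J. c s * c t * (\<integral>\<omega>. V s \<omega> * V t \<omega> \<partial>N))" for c
    using eq J by (intro sum.cong refl) auto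
  then show "distr M (PiM J (\<lambda>_. borel)) (\<lambda>\<omega>. \<lambda>t\<in>J. U t \<omega>) = distr N (PiM J (\<lambda>_. borel)) (\<lambda>\<omega>. \<lambda>t\<in>J. V t \<omega>)"
    using J centred_gaussian_processD(1,2)[OF U] centred_gaussian_processD(1,2)[OF V]
    by (intro distr_PiM_eq_of_char_eq)
       (auto simp only: centred_gaussian_process_char[OF U J] centred_gaussian_process_char[OF V J])
qed

text \<open>Since \<psi> may identify times, the coefficients of all times with the same image are
  first collected; what remains is a linear combination of \<open>X\<close> over distinct
  indices.\<close>

lemma centred_gaussian_process_scale_reindex:
  assumes X: "centred_gaussian_process N I X" and psi: "\<psi> ` S \<subseteq> I"
  shows "centred_gaussian_process N S (\<lambda>t \<omega>. a t * X (\<psi> t) \<omega>)"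
  unfolding centred_gaussian_process_def gaussian_process_def
proof (intro conjI allI impI ballI; (elim conjE)?)
  show "prob_space N" by (rule centred_gaussian_processD(1)[OF X])
  show "(\<integral>\<omega>. a t * X (\<psi> t) \<omega> \<partial>N) = 0" if "t \<in> S" for t
    using centred_gaussian_processD(4)[OF X, of "\<psi> t"] that psi by auto
  fix F c assume F: "finite F" "F \<subseteq> S"
  have "(\<Sum>t\<in>F. c t * (a t * X (\<psi> t) \<omega>)) = (\<Sum>i\<in>\<psi> ` F. (\<Sum>t\<in>{t\<in>F. \<psi> t = i}. c t * a t) * X i \<omega>)" for \<omega>
    by (subst sum.image_gen[OF F(1), of _ \<psi>]) (auto simp: sum_distrib_right mult.assoc intro!: sum.cong)
  moreover have "gaussian_rv N (\<lambda>\<omega>. \<Sum>i\<in>\<psi> ` F. (\<Sum>t\<in>{t\<in>F. \<psi> t = i}. c t * a t) * X i \<omega>)"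
    by (rule centred_gaussian_process_gaussian_rv[OF X]) (use F psi in auto)
  ultimately show "gaussian_rv N (\<lambda>\<omega>. \<Sum>t\<in>F. c t * (a t * X (\<psi> t) \<omega>))" by simp
qed

lemma centred_gaussian_process_subset:
  "centred_gaussian_process M T Z \<Longrightarrow> S \<subseteq> T \<Longrightarrow> centred_gaussian_process M S Z"
  unfolding centred_gaussian_process_def gaussian_process_def by blast

section \<open>Independence of uncorrelated blocks\<close>

text \<open>Taking preimages commutes with generating a sigma-algebra. Independence of process
  restrictions can therefore be tested on cylinder events.\<close>

lemma sigma_sets_vimage_PiM:
  assumes X: "X \<in> \<Omega> \<rightarrow> space (PiM I N)"
  shows "sigma_sets \<Omega> {X -` A \<inter> \<Omega> | A. A \<in> sets (PiM I N)} = sigma_sets \<Omega> {X -` A \<inter> \<Omega> | A. A \<in> prod_algebra I N}"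
proof -
  have X': "X \<in> \<Omega> \<rightarrow> (\<Pi>\<^sub>E i\<in>I. space (N i))" using X by (simp add: space_PiM)
  have "{X -` A \<inter> \<Omega> | A. A \<in> sets (PiM I N)} = sigma_sets \<Omega> {X -` A \<inter> \<Omega> | A. A \<in> prod_algebra I N}"
    unfolding sets_PiM by (rule sigma_sets_vimage_commute[OF X'])
  then show ?thesis by (simp add: sigma_sets_sigma_sets_eq) (rule sigma_sets_sigma_sets_eq, auto)
qed

text \<open>The law of the two blocks is compared with that of independent copies of them, which
  live on \<open>M \<Otimes>\<^sub>M M\<close>.\<close>

lemma prob_blocks_of_uncorrelated:
  assumes Z: "centred_gaussian_process M T Z"
    and J: "finite J" "J \<subseteq> T" and J': "finite J'" "J' \<subseteq> T" and disj: "J \<inter> J' = {}"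
    and orth: "\<And>s t. s \<in> J \<Longrightarrow> t \<in> J' \<Longrightarrow> (\<integral>\<omega>. Z s \<omega> * Z t \<omega> \<partial>M) = 0"
    and E: "\<And>t. t \<in> J \<Longrightarrow> E t \<in> sets borel" and E': "\<And>t. t \<in> J' \<Longrightarrow> E' t \<in> sets borel"
  shows "measure M {\<omega>\<in>space M. (\<forall>t\<in>J. Z t \<omega> \<in> E t) \<and> (\<forall>t\<in>J'. Z t \<omega> \<in> E' t)} =
    measure M {\<omega>\<in>space M. \<forall>t\<in>J. Z t \<omega> \<in> E t} * measure M {\<omega>\<in>space M. \<forall>t\<in>J'. Z t \<omega> \<in> E' t}"
proof -
  note D = centred_gaussian_processD[OF Z]
  interpret prob_space M by (rule D(1))
  interpret P: pair_prob_space M M ..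
  define G where "G = J \<union> J'"
  have G: "finite G" "G \<subseteq> T" using J J' by (auto simp: G_def)
  have mZ[measurable]: "Z t \<in> borel_measurable M" if "t \<in> G" for t using that D(2) G(2) by blast
  \<comment> \<open>On \<open>J\<close> the first copy is read; on the rest of \<open>G\<close>,
    which is \<open>J'\<close> by disjointness, the second.\<close>
  define V where "V t \<omega> = (if t \<in> J then Z t (fst \<omega>) else Z t (snd \<omega>))" for t \<omega>
  have mV[measurable]: "V t \<in> borel_measurable (M \<Otimes>\<^sub>M M)" if "t \<in> G" for t
    unfolding V_def using that by (cases "t \<in> J") auto
  have char: "(CLINT \<omega>|M. iexp (\<Sum>t\<in>G. c t * Z t \<omega>)) = (CLINT \<omega>|M \<Otimes>\<^sub>M M. iexp (\<Sum>t\<in>G. c t * V t \<omega>))" for c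
  proof -
    define a where "a \<omega> = (\<Sum>t\<in>J. c t * Z t \<omega>)" for \<omega>
    define b where "b \<omega> = (\<Sum>t\<in>J'. c t * Z t \<omega>)" for \<omega>
    let ?K = "\<lambda>s t. c s * c t * (\<integral>\<omega>. Z s \<omega> * Z t \<omega> \<partial>M)"
    have [measurable]: "a \<in> borel_measurable M" "b \<in> borel_measurable M"
      unfolding a_def b_def by (auto simp: G_def)
    have "(\<Sum>t\<in>G. c t * V t (\<omega>1, \<omega>2)) = a \<omega>1 + b \<omega>2" for \<omega>1 \<omega>2
    proof -
      have "(\<Sum>t\<in>G. c t * V t (\<omega>1, \<omega>2)) = (\<Sum>t\<in>J. c t * V t (\<omega>1, \<omega>2)) + (\<Sum>t\<in>J'. c t * V t (\<omega>1, \<omega>2))"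
        unfolding G_def using J J' disj by (intro sum.union_disjoint) auto
      also have "(\<Sum>t\<in>J. c t * V t (\<omega>1, \<omega>2)) = a \<omega>1"
        unfolding a_def V_def by (intro sum.cong) auto
      also have "(\<Sum>t\<in>J'. c t * V t (\<omega>1, \<omega>2)) = b \<omega>2"
        unfolding b_def V_def using disj by (intro sum.cong) auto
      finally show ?thesis .
    qed
    then have "(CLINT \<omega>|M \<Otimes>\<^sub>M M. iexp (\<Sum>t\<in>G. c t * V t \<omega>)) = (CLINT \<omega>1|M. CLINT \<omega>2|M. iexp (a \<omega>1 + b \<omega>2))"
      by (subst P.integral_fst'[symmetric]) (auto intro!: P.integrable_iexp)
    also have "\<dots> = (CLINT \<omega>1|M. CLINT \<omega>2|M. iexp (a \<omega>1) * iexp (b \<omega>2))"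
      by (simp add: distrib_left exp_add)
    also have "\<dots> = (CLINT \<omega>|M. iexp (a \<omega>)) * (CLINT \<omega>|M. iexp (b \<omega>))"
      by simp
    also have "\<dots> = complex_of_real (exp (- ((\<Sum>s\<in>J. \<Sum>t\<in>J. ?K s t) + (\<Sum>s\<in>J'. \<Sum>t\<in>J'. ?K s t)) / 2))"
      unfolding a_def b_def centred_gaussian_process_char[OF Z J] centred_gaussian_process_char[OF Z J']
      by (simp add: exp_add[symmetric] add_divide_distrib flip: of_real_mult)
    \<comment> \<open>By \<open>orth\<close> the mixed blocks contribute nothing, so the two
      separate quadratic forms add up to the form over the union.\<close>
    also have "(\<Sum>s\<in>J. \<Sum>t\<in>J. ?K s t) + (\<Sum>s\<in>J'. \<Sum>t\<in>J'. ?K s t) = (\<Sum>s\<in>G. \<Sum>t\<in>G. ?K s t)"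
    proof -
      have "(\<Sum>t\<in>J'. ?K s t) = 0" if "s \<in> J" for s using orth that by (intro sum.neutral) auto
      moreover have "(\<Sum>t\<in>J. ?K s t) = 0" if "s \<in> J'" for s
        using orth that by (intro sum.neutral) (auto simp: mult.commute)
      ultimately show ?thesis
        unfolding G_def using J J' disj by (simp add: sum.union_disjoint)
    qed
    also have "complex_of_real (exp (- (\<Sum>s\<in>G. \<Sum>t\<in>G. ?K s t) / 2)) = (CLINT \<omega>|M. iexp (\<Sum>t\<in>G. c t * Z t \<omega>))"
      using centred_gaussian_process_char[OF Z G] by simp
    finally show ?thesis by simp
  qed
  have eq: "distr M (PiM G (\<lambda>_. borel)) (\<lambda>\<omega>. \<lambda>t\<in>G. Z t \<omega>) = distr (M \<Otimes>\<^sub>M M) (PiM G (\<lambda>_. borel)) (\<lambda>\<omega>. \<lambda>t\<in>G. V t \<omega>)"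
    by (rule distr_PiM_eq_of_char_eq[OF D(1) P.prob_space_axioms G(1) mZ mV char])
  define B where "B = PiE G (\<lambda>t. if t \<in> J then E t else E' t)"
  have B: "B \<in> sets (PiM G (\<lambda>_. borel))"
    unfolding B_def using G E E' by (intro sets_PiM_I_finite) (auto simp: G_def)
  define S where "S = {\<omega>\<in>space M. \<forall>t\<in>J. Z t \<omega> \<in> E t}"
  define S' where "S' = {\<omega>\<in>space M. \<forall>t\<in>J'. Z t \<omega> \<in> E' t}"
  have m: "(\<lambda>\<omega>. \<lambda>t\<in>G. Z t \<omega>) \<in> M \<rightarrow>\<^sub>M PiM G (\<lambda>_. borel)"
    "(\<lambda>\<omega>. \<lambda>t\<in>G. V t \<omega>) \<in> M \<Otimes>\<^sub>M M \<rightarrow>\<^sub>M PiM G (\<lambda>_. borel)" by (auto intro!: measurable_restrict)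
  have "S = (\<Inter>t\<in>J. Z t -` E t \<inter> space M) \<inter> space M" "S' = (\<Inter>t\<in>J'. Z t -` E' t \<inter> space M) \<inter> space M"
    by (auto simp: S_def S'_def)
  moreover have "(\<Inter>t\<in>J. Z t -` E t \<inter> space M) \<inter> space M \<in> sets M"
    using J(1) E measurable_sets[OF mZ] by (cases "J = {}") (auto simp: G_def intro!: sets.Int sets.finite_INT)
  moreover have "(\<Inter>t\<in>J'. Z t -` E' t \<inter> space M) \<inter> space M \<in> sets M"
    using J'(1) E' measurable_sets[OF mZ] by (cases "J' = {}") (auto simp: G_def intro!: sets.Int sets.finite_INT)
  ultimately have SS: "S \<in> sets M" "S' \<in> sets M" by auto
  have nJ: "t \<notin> J" if "t \<in> J'" for t using that disj by auto
  have "(\<lambda>\<omega>. \<lambda>t\<in>G. Z t \<omega>) -` B \<inter> space M = {\<omega>\<in>space M. (\<forall>t\<in>J. Z t \<omega> \<in> E t) \<and> (\<forall>t\<in>J'. Z t \<omega> \<in> E' t)}"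
    using nJ by (auto simp: B_def G_def PiE_iff ball_Un)
  then have "measure M {\<omega>\<in>space M. (\<forall>t\<in>J. Z t \<omega> \<in> E t) \<and> (\<forall>t\<in>J'. Z t \<omega> \<in> E' t)} =
     measure (distr M (PiM G (\<lambda>_. borel)) (\<lambda>\<omega>. \<lambda>t\<in>G. Z t \<omega>)) B"
    using measure_distr[OF m(1) B] by simp
  also have "\<dots> = measure (M \<Otimes>\<^sub>M M) ((\<lambda>\<omega>. \<lambda>t\<in>G. V t \<omega>) -` B \<inter> space (M \<Otimes>\<^sub>M M))"
    unfolding eq by (rule measure_distr[OF m(2) B])
  \<comment> \<open>The two halves of the box constrain different copies, so its preimage is a
    rectangle, and the product measure factors.\<close>
  also have "(\<lambda>\<omega>. \<lambda>t\<in>G. V t \<omega>) -` B \<inter> space (M \<Otimes>\<^sub>M M) = S \<times> S'"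
    using nJ by (auto simp: B_def G_def PiE_iff V_def S_def S'_def space_pair_measure ball_Un)
  also have "measure (M \<Otimes>\<^sub>M M) (S \<times> S') = measure M S * measure M S'"
    using SS by (simp add: measure_def emeasure_pair_measure_Times enn2real_mult)
  finally show ?thesis unfolding S_def S'_def .
qed

text \<open>The blocks may be infinite, but a cylinder event involves only finitely many times, so
  the finite product formula covers it. Cylinder events are stable under intersection and generate,
  hence independence extends to the full sigma-algebras.\<close>

lemma indep_var_of_uncorrelated:
  assumes Z: "centred_gaussian_process M T Z"
    and S: "S \<subseteq> T" "S' \<subseteq> T" and disj: "S \<inter> S' = {}"
    and orth: "\<And>s t. s \<in> S \<Longrightarrow> t \<in> S' \<Longrightarrow> (\<integral>\<omega>. Z s \<omega> * Z t \<omega> \<partial>M) = 0"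
  shows "prob_space.indep_var M
    (PiM S (\<lambda>_. borel)) (\<lambda>\<omega>. \<lambda>t\<in>S. Z t \<omega>) (PiM S' (\<lambda>_. borel)) (\<lambda>\<omega>. \<lambda>t\<in>S'. Z t \<omega>)"
proof -
  note D = centred_gaussian_processD[OF Z]
  interpret prob_space M by (rule D(1))
  have m: "(\<lambda>\<omega>. \<lambda>t\<in>R. Z t \<omega>) \<in> M \<rightarrow>\<^sub>M PiM R (\<lambda>_. borel)" if "R \<subseteq> T" for R
    using that D(2) by (intro measurable_restrict) auto
  define C where "C R = {(\<lambda>\<omega>. \<lambda>t\<in>R. Z t \<omega>) -` A \<inter> space M |A. A \<in> prod_algebra R (\<lambda>_. borel :: real measure)}" for R
  have CE: "\<exists>J E. finite J \<and> J \<subseteq> R \<and> (\<forall>t\<in>J. E t \<in> sets borel) \<and> a = {\<omega>\<in>space M. \<forall>t\<in>J. Z t \<omega> \<in> E t}"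
    if aC: "a \<in> C R" for a R
  proof -
    obtain A where A: "A \<in> prod_algebra R (\<lambda>_. borel :: real measure)" "a = (\<lambda>\<omega>. \<lambda>t\<in>R. Z t \<omega>) -` A \<inter> space M"
      using aC unfolding C_def by blast
    from A(1) obtain J E where JE: "A = prod_emb R (\<lambda>_. borel) J (Pi\<^sub>E J E)" "finite J" "J \<subseteq> R" "\<And>i. i \<in> J \<Longrightarrow> E i \<in> sets (borel :: real measure)"
      by (rule prod_algebraE) blast
    have "a = {\<omega>\<in>space M. \<forall>t\<in>J. Z t \<omega> \<in> E t}"
      unfolding A(2) JE(1) using JE(3) by (auto simp: prod_emb_def PiE_iff subset_iff)
    then show ?thesis using JE by blast
  qed
  have sub: "C R \<subseteq> sets M" if "R \<subseteq> T" for R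
    using measurable_sets[OF m[OF that]] sets_PiM_I_finite unfolding C_def
    by (auto simp: sets_PiM intro!: sigma_sets.Basic)
  have stable: "Int_stable (C R)" for R
  proof (rule Int_stableI)
    fix a b assume "a \<in> C R" "b \<in> C R"
    then obtain A B where AB: "A \<in> prod_algebra R (\<lambda>_. borel :: real measure)" "B \<in> prod_algebra R (\<lambda>_. borel :: real measure)"
      "a = (\<lambda>\<omega>. \<lambda>t\<in>R. Z t \<omega>) -` A \<inter> space M" "b = (\<lambda>\<omega>. \<lambda>t\<in>R. Z t \<omega>) -` B \<inter> space M"
      unfolding C_def by auto
    then have "A \<inter> B \<in> prod_algebra R (\<lambda>_. borel :: real measure)"
      using Int_stable_prod_algebra by (auto dest: Int_stableD)
    moreover have "a \<inter> b = (\<lambda>\<omega>. \<lambda>t\<in>R. Z t \<omega>) -` (A \<inter> B) \<inter> space M" using AB by auto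
    ultimately show "a \<inter> b \<in> C R" unfolding C_def by blast
  qed
  have "indep_set (C S) (C S')"
  proof (rule indep_setI)
    fix a b assume "a \<in> C S" "b \<in> C S'"
    obtain J E where a: "finite J" "J \<subseteq> S" "\<forall>t\<in>J. E t \<in> sets borel" "a = {\<omega>\<in>space M. \<forall>t\<in>J. Z t \<omega> \<in> E t}"
      using CE[OF \<open>a \<in> C S\<close>] by blast
    obtain J' E' where b: "finite J'" "J' \<subseteq> S'" "\<forall>t\<in>J'. E' t \<in> sets borel" "b = {\<omega>\<in>space M. \<forall>t\<in>J'. Z t \<omega> \<in> E' t}"
      using CE[OF \<open>b \<in> C S'\<close>] by blast
    have J: "J \<subseteq> T" and J': "J' \<subseteq> T" and JJ': "J \<inter> J' = {}" using a(2) b(2) S disj by blast+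
    have "a \<inter> b = {\<omega>\<in>space M. (\<forall>t\<in>J. Z t \<omega> \<in> E t) \<and> (\<forall>t\<in>J'. Z t \<omega> \<in> E' t)}" using a b by auto
    then show "prob (a \<inter> b) = prob a * prob b"
      unfolding a(4) b(4)
      using prob_blocks_of_uncorrelated[OF Z a(1) J b(1) J' JJ', of E E'] a(2,3) b(2,3) orth by (auto simp: subset_iff)
  qed (use sub S in auto)
  then have "indep_set (sigma_sets (space M) (C S)) (sigma_sets (space M) (C S'))"
    by (rule indep_set_sigma_sets[OF _ stable stable])
  moreover have "sigma_sets (space M) {(\<lambda>\<omega>. \<lambda>t\<in>R. Z t \<omega>) -` A \<inter> space M | A. A \<in> sets (PiM R (\<lambda>_. borel))} = sigma_sets (space M) (C R)"
    if "R \<subseteq> T" for R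
    unfolding C_def using measurable_space[OF m[OF that]] by (intro sigma_sets_vimage_PiM) auto
  ultimately show ?thesis
    using m S by (simp add: indep_var_eq)
qed

section \<open>Realisation of Gaussian laws\<close>

abbreviation gaussian_sequence :: "(nat \<Rightarrow> real) measure" where
  "gaussian_sequence \<equiv> PiM UNIV (\<lambda>_. std_normal_distribution)"

lemma prob_space_std_normal_distribution: "prob_space std_normal_distribution"
  by (rule prob_space_normal_density) simp

lemma prob_space_gaussian_sequence: "prob_space gaussian_sequence"
  by (intro prob_space_PiM prob_space_std_normal_distribution)

lemma measurable_gaussian_sequence [measurable]:
  "(\<lambda>\<omega>. \<omega> n) \<in> borel_measurable gaussian_sequence"
  using measurable_component_singleton[of n UNIV "\<lambda>_. std_normal_distribution"]
  by (simp cong: measurable_cong_sets)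

lemma distr_gaussian_sequence: "distr gaussian_sequence borel (\<lambda>\<omega>. \<omega> n) = std_normal_distribution"
proof -
  have "distr gaussian_sequence std_normal_distribution (\<lambda>\<omega>. \<omega> n) = std_normal_distribution"
    by (rule distr_PiM_component) (auto intro: prob_space_std_normal_distribution)
  then show ?thesis by (simp cong: distr_cong)
qed

lemma indep_vars_gaussian_sequence:
  "prob_space.indep_vars gaussian_sequence (\<lambda>_. borel) (\<lambda>n \<omega>. \<omega> n) UNIV"
proof -
  interpret prob_space gaussian_sequence by (rule prob_space_gaussian_sequence)
  have s: "sets (PiM UNIV (\<lambda>_. borel)) = sets gaussian_sequence"
    by (intro sets_PiM_cong) auto
  have "distr gaussian_sequence (PiM UNIV (\<lambda>_. borel)) (\<lambda>\<omega>. \<lambda>i\<in>UNIV. \<omega> i) =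
    distr gaussian_sequence gaussian_sequence (\<lambda>\<omega>. \<omega>)"
    using s by (intro distr_cong) auto
  then show ?thesis
    by (subst indep_vars_iff_distr_eq_PiM) (auto simp: distr_gaussian_sequence)
qed

lemma char_gaussian_sequence_sum:
  "(CLINT \<omega>|gaussian_sequence. iexp (\<Sum>n<m. b n * \<omega> n)) = exp (- (\<Sum>n<m. (b n)\<^sup>2) / 2)"
proof -
  interpret prob_space gaussian_sequence by (rule prob_space_gaussian_sequence)
  have 1: "char (distr gaussian_sequence borel (\<lambda>\<omega>. b n * \<omega> n)) 1 = exp (- (b n)\<^sup>2 / 2)" for n
  proof -
    have "char (distr gaussian_sequence borel (\<lambda>\<omega>. b n * \<omega> n)) 1 = char (distr gaussian_sequence borel (\<lambda>\<omega>. \<omega> n)) (b n)"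
      by (simp add: char_def integral_distr)
    then show ?thesis by (simp add: distr_gaussian_sequence char_std_normal_distribution)
  qed
  have "indep_vars (\<lambda>_. borel) (\<lambda>n \<omega>. b n * \<omega> n) {..<m}"
    using indep_vars_compose2[OF indep_vars_subset[OF indep_vars_gaussian_sequence, of "{..<m}"], of "\<lambda>n x. b n * x" "\<lambda>_. borel"]
    by simp
  from char_distr_sum[OF this, of 1]
  have "char (distr gaussian_sequence borel (\<lambda>\<omega>. \<Sum>n<m. b n * \<omega> n)) 1 = (\<Prod>n<m. exp (- (b n)\<^sup>2 / 2))"
    unfolding 1 by simp
  also have "\<dots> = exp (\<Sum>n<m. - (b n)\<^sup>2 / 2)" by (simp add: exp_sum)
  finally show ?thesis by (simp add: char_def integral_distr sum_divide_distrib sum_negf)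
qed

text \<open>From \<open>\<bar>x\<bar> \<le> (1 + x^2) / 2\<close> and unit variance, each term has
  absolute first moment at most \<open>\<bar>b n\<bar>\<close>. The series of absolute values thus
  has finite expectation and is finite almost everywhere.\<close>

lemma AE_summable_gaussian_sequence:
  assumes "summable (\<lambda>n. \<bar>b n\<bar>)"
  shows "AE \<omega> in gaussian_sequence. summable (\<lambda>n. b n * \<omega> n)"
proof -
  interpret prob_space gaussian_sequence by (rule prob_space_gaussian_sequence)
  have le: "(\<integral>\<^sup>+\<omega>. ennreal \<bar>b n * \<omega> n\<bar> \<partial>gaussian_sequence) \<le> ennreal \<bar>b n\<bar>" for n
  proof -
    have i2: "integrable gaussian_sequence (\<lambda>\<omega>. (\<omega> n)\<^sup>2)" "(\<integral>\<omega>. (\<omega> n)\<^sup>2 \<partial>gaussian_sequence) = 1"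
    proof -
      have "integrable (distr gaussian_sequence borel (\<lambda>\<omega>. \<omega> n)) (\<lambda>x. x\<^sup>2)"
        unfolding distr_gaussian_sequence by (rule integrable_std_normal_distribution_moment)
      then show "integrable gaussian_sequence (\<lambda>\<omega>. (\<omega> n)\<^sup>2)" by (simp add: integrable_distr_eq)
      have "(\<integral>x. x\<^sup>2 \<partial>distr gaussian_sequence borel (\<lambda>\<omega>. \<omega> n)) = 1"
        unfolding distr_gaussian_sequence using std_normal_distribution_even_moments(1)[of 1] by simp
      then show "(\<integral>\<omega>. (\<omega> n)\<^sup>2 \<partial>gaussian_sequence) = 1" by (simp add: integral_distr)
    qed
    have "(\<integral>\<^sup>+\<omega>. ennreal \<bar>b n * \<omega> n\<bar> \<partial>gaussian_sequence) \<le> (\<integral>\<^sup>+\<omega>. ennreal (\<bar>b n\<bar> * ((1 + (\<omega> n)\<^sup>2) / 2)) \<partial>gaussian_sequence)"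
    proof (intro nn_integral_mono ennreal_leI)
      fix \<omega> :: "nat \<Rightarrow> real"
      have "0 \<le> (1 - \<bar>\<omega> n\<bar>)\<^sup>2" by simp
      then have "\<bar>\<omega> n\<bar> \<le> (1 + (\<omega> n)\<^sup>2) / 2" by (simp add: power2_diff)
      then show "\<bar>b n * \<omega> n\<bar> \<le> \<bar>b n\<bar> * ((1 + (\<omega> n)\<^sup>2) / 2)"
        unfolding abs_mult by (rule mult_left_mono) simp
    qed
    also have "\<dots> = ennreal (\<integral>\<omega>. \<bar>b n\<bar> * ((1 + (\<omega> n)\<^sup>2) / 2) \<partial>gaussian_sequence)"
      using i2 by (intro nn_integral_eq_integral) auto
    also have "(\<integral>\<omega>. \<bar>b n\<bar> * ((1 + (\<omega> n)\<^sup>2) / 2) \<partial>gaussian_sequence) = \<bar>b n\<bar>"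
      using i2 by (simp add: prob_space)
    finally show ?thesis .
  qed
  have "(\<integral>\<^sup>+\<omega>. (\<Sum>n. ennreal \<bar>b n * \<omega> n\<bar>) \<partial>gaussian_sequence) = (\<Sum>n. \<integral>\<^sup>+\<omega>. ennreal \<bar>b n * \<omega> n\<bar> \<partial>gaussian_sequence)"
    by (rule nn_integral_suminf) measurable
  also have "\<dots> \<le> (\<Sum>n. ennreal \<bar>b n\<bar>)"
    by (intro suminf_le le) auto
  also have "\<dots> < \<infinity>"
    using ennreal_suminf_neq_top[OF assms abs_ge_zero] by (simp add: less_top)
  finally have "AE \<omega> in gaussian_sequence. (\<Sum>n. ennreal \<bar>b n * \<omega> n\<bar>) \<noteq> \<infinity>"
    by (intro nn_integral_noteq_infinite) auto
  then show ?thesis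
  proof eventually_elim
    case (elim \<omega>)
    then have "summable (\<lambda>n. \<bar>b n * \<omega> n\<bar>)"
      by (intro summable_suminf_not_top) auto
    then show ?case by (rule summable_rabs_cancel)
  qed
qed

text \<open>A kernel given as inner products of coefficient sequences is realised by using the same
  sequences as coefficients of independent standard normals. Absolute summability of
  \<open>f i\<close> provides almost sure convergence; the covariance is read off the limit of
  characteristic functions of partial sums.\<close>

lemma centred_gaussian_process_series:
  fixes f :: "'i \<Rightarrow> nat \<Rightarrow> real"
  assumes f: "\<And>i. summable (\<lambda>n. \<bar>f i n\<bar>)"
    and K: "\<And>i j. (\<lambda>n. f i n * f j n) sums K i j"
  shows "centred_gaussian_process gaussian_sequence UNIV (\<lambda>i \<omega>. \<Sum>n. f i n * \<omega> n)"
    and "\<And>i j. (\<integral>\<omega>. (\<Sum>n. f i n * \<omega> n) * (\<Sum>n. f j n * \<omega> n) \<partial>gaussian_sequence) = K i j"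
proof -
  interpret prob_space gaussian_sequence by (rule prob_space_gaussian_sequence)
  have K_sym: "K i j = K j i" for i j
    using K[of i j] K[of j i] by (simp add: mult.commute sums_iff)
  have [measurable]: "(\<lambda>\<omega>. \<Sum>n. f i n * \<omega> n) \<in> borel_measurable gaussian_sequence" for i
    by measurable
  have ch: "(CLINT \<omega>|gaussian_sequence. iexp (\<Sum>i\<in>F. c i * (\<Sum>n. f i n * \<omega> n))) = exp (- (\<Sum>i\<in>F. \<Sum>j\<in>F. c i * c j * K i j) / 2)"
    if F: "finite F" for F c
  proof -
    \<comment> \<open>The coefficient of the \<open>n\<close>-th normal in the whole linear
      combination; the square sum of \<open>b\<close> is the quadratic form of \<open>K\<close> at
      \<open>c\<close>.\<close>
    define b where "b n = (\<Sum>i\<in>F. c i * f i n)" for n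
    have "AE \<omega> in gaussian_sequence. \<forall>i\<in>F. summable (\<lambda>n. f i n * \<omega> n)"
      using F by (intro AE_finite_allI AE_summable_gaussian_sequence f)
    then have lim: "AE \<omega> in gaussian_sequence. (\<lambda>m. iexp (\<Sum>n<m. b n * \<omega> n)) \<longlonglongrightarrow> iexp (\<Sum>i\<in>F. c i * (\<Sum>n. f i n * \<omega> n))"
    proof eventually_elim
      case (elim \<omega>)
      have "(\<lambda>n. \<Sum>i\<in>F. c i * (f i n * \<omega> n)) sums (\<Sum>i\<in>F. c i * (\<Sum>n. f i n * \<omega> n))"
        using elim by (intro sums_sum sums_mult summable_sums) auto
      moreover have "(\<Sum>i\<in>F. c i * (f i n * \<omega> n)) = b n * \<omega> n" for n
        by (simp add: b_def sum_distrib_right mult.assoc)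
      ultimately have "(\<lambda>m. \<Sum>n<m. b n * \<omega> n) \<longlonglongrightarrow> (\<Sum>i\<in>F. c i * (\<Sum>n. f i n * \<omega> n))"
        by (simp add: sums_def)
      then show ?case
        by (intro tendsto_exp tendsto_mult tendsto_const tendsto_of_real)
    qed
    have "(\<lambda>m. CLINT \<omega>|gaussian_sequence. iexp (\<Sum>n<m. b n * \<omega> n)) \<longlonglongrightarrow>
        (CLINT \<omega>|gaussian_sequence. iexp (\<Sum>i\<in>F. c i * (\<Sum>n. f i n * \<omega> n)))"
      by (rule integral_dominated_convergence[where w="\<lambda>_. 1"]) (use lim in auto)
    moreover have "(\<lambda>m. CLINT \<omega>|gaussian_sequence. iexp (\<Sum>n<m. b n * \<omega> n)) \<longlonglongrightarrow>
        complex_of_real (exp (- (\<Sum>i\<in>F. \<Sum>j\<in>F. c i * c j * K i j) / 2))"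
    proof -
      have "(\<lambda>n. \<Sum>i\<in>F. \<Sum>j\<in>F. c i * c j * (f i n * f j n)) sums (\<Sum>i\<in>F. \<Sum>j\<in>F. c i * c j * K i j)"
        by (intro sums_sum sums_mult K)
      moreover have "(\<Sum>i\<in>F. \<Sum>j\<in>F. c i * c j * (f i n * f j n)) = (b n)\<^sup>2" for n
        by (simp add: b_def power2_eq_square sum_product ac_simps)
      ultimately have "(\<lambda>m. \<Sum>n<m. (b n)\<^sup>2) \<longlonglongrightarrow> (\<Sum>i\<in>F. \<Sum>j\<in>F. c i * c j * K i j)"
        by (simp add: sums_def)
      then show ?thesis
        unfolding char_gaussian_sequence_sum
        by (intro tendsto_of_real tendsto_exp tendsto_divide tendsto_minus) auto
    qed
    ultimately show ?thesis by (rule LIMSEQ_unique)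
  qed
  note * = centred_gaussian_process_of_char[OF prob_space_axioms _ K_sym ch, where T=UNIV]
  show "centred_gaussian_process gaussian_sequence UNIV (\<lambda>i \<omega>. \<Sum>n. f i n * \<omega> n)"
    by (rule *(1)) auto
  show "\<And>i j. (\<integral>\<omega>. (\<Sum>n. f i n * \<omega> n) * (\<Sum>n. f j n * \<omega> n) \<partial>gaussian_sequence) = K i j"
    by (rule *(2)) auto
qed

text \<open>The properties demanded by \<open>SOME\<close> hold of the chosen law as soon as one
  measure has them. The image of \<open>M\<close> under the path map of \<open>X\<close> is such a
  measure.\<close>

lemma centred_gaussian_law_of_process:
  assumes X: "centred_gaussian_process M UNIV X" and K: "\<And>s t. (\<integral>\<omega>. X s \<omega> * X t \<omega> \<partial>M) = K s t"
  shows "centred_gaussian_process (centred_gaussian_law K) UNIV (\<lambda>s \<omega>. \<omega> s)"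
    and "\<And>s t. (\<integral>\<omega>. \<omega> s * \<omega> t \<partial>centred_gaussian_law K) = K s t"
proof -
  note D = centred_gaussian_processD[OF X]
  interpret prob_space M by (rule D(1))
  define \<mu> where "\<mu> = distr M (PiM UNIV (\<lambda>_. borel)) (\<lambda>\<omega> s. X s \<omega>)"
  have m: "(\<lambda>\<omega> s. X s \<omega>) \<in> M \<rightarrow>\<^sub>M PiM UNIV (\<lambda>_. borel)"
    using measurable_restrict[of UNIV X M "\<lambda>_. borel"] D(2) by (simp add: restrict_UNIV)
  interpret \<mu>: prob_space \<mu> unfolding \<mu>_def by (rule prob_space_distr[OF m])
  have ch: "(CLINT \<omega>|\<mu>. iexp (\<Sum>t\<in>F. c t * \<omega> t)) = exp (- (\<Sum>s\<in>F. \<Sum>t\<in>F. c s * c t * K s t) / 2)"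
    if "finite F" for F c
  proof -
    have "(CLINT \<omega>|\<mu>. iexp (\<Sum>t\<in>F. c t * \<omega> t)) = (CLINT \<omega>|M. iexp (\<Sum>t\<in>F. c t * X t \<omega>))"
      unfolding \<mu>_def by (rule integral_distr[OF m]) measurable
    then show ?thesis using centred_gaussian_process_char[OF X that, of c] by (simp add: K)
  qed
  have K_sym: "K s t = K t s" for s t unfolding K[symmetric] by (simp add: mult.commute)
  have m\<mu>: "(\<lambda>\<omega>. \<omega> s) \<in> borel_measurable \<mu>" for s unfolding \<mu>_def by simp
  note * = centred_gaussian_process_of_char[OF \<mu>.prob_space_axioms _ K_sym ch, where T=UNIV]
  have "sets \<mu> = sets (PiM UNIV (\<lambda>_. borel)) \<and>
     centred_gaussian_process \<mu> UNIV (\<lambda>s \<omega>. \<omega> s) \<and>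
     (\<forall>s t. (\<integral>\<omega>. \<omega> s * \<omega> t \<partial>\<mu>) = K s t)"
    using *(1)[OF m\<mu>] *(2)[OF m\<mu>] by (auto simp: \<mu>_def)
  from someI[of "\<lambda>\<mu>. sets \<mu> = sets (PiM UNIV (\<lambda>_. borel)) \<and>
     centred_gaussian_process \<mu> UNIV (\<lambda>s \<omega>. \<omega> s) \<and>
     (\<forall>s t. (\<integral>\<omega>. \<omega> s * \<omega> t \<partial>\<mu>) = K s t)", OF this]
  show "centred_gaussian_process (centred_gaussian_law K) UNIV (\<lambda>s \<omega>. \<omega> s)"
    and "\<And>s t. (\<integral>\<omega>. \<omega> s * \<omega> t \<partial>centred_gaussian_law K) = K s t"
    unfolding centred_gaussian_law_def by auto
qed

text \<open>With \<open>r = tanh s\<close> the kernel of the process is the normalised Szego kernel \<open>1 / (1 - r r')\<close>,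
  so \<open>X\<close> is realised by the random power series \<open>\<Sum>n. \<xi>\<^sub>n r^n\<close>.\<close>

lemma tanh_power_sums_sech:
  fixes s t :: real
  shows "(\<lambda>n. (tanh s ^ n / cosh s) * (tanh t ^ n / cosh t)) sums (1 / cosh (t - s))"
proof -
  have "\<bar>tanh s * tanh t\<bar> < 1"
    using mult_strict_mono'[of "\<bar>tanh s\<bar>" 1 "\<bar>tanh t\<bar>" 1] tanh_real_bounds[of s] tanh_real_bounds[of t]
    by (auto simp: abs_mult abs_less_iff)
  then have "(\<lambda>n. (tanh s * tanh t) ^ n) sums (1 / (1 - tanh s * tanh t))"
    by (intro geometric_sums) simp
  from sums_mult[OF this, of "1 / (cosh s * cosh t)"]
  have "(\<lambda>n. (tanh s ^ n / cosh s) * (tanh t ^ n / cosh t)) sums (1 / (cosh s * cosh t) * (1 / (1 - tanh s * tanh t)))"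
    by (simp add: power_mult_distrib)
  also have "1 / (cosh s * cosh t) * (1 / (1 - tanh s * tanh t)) = 1 / cosh (t - s)"
    by (simp add: cosh_diff tanh_def field_simps)
  finally show ?thesis .
qed

lemma X_law:
  "centred_gaussian_process X_law UNIV X_proc"
  "(\<integral>\<omega>. X_proc s \<omega> * X_proc t \<omega> \<partial>X_law) = 1 / cosh (s - t)"
proof -
  have f: "summable (\<lambda>n. \<bar>tanh s ^ n / cosh s\<bar>)" for s :: real
    using tanh_real_bounds[of s]
    by (auto simp: power_abs abs_less_iff intro!: summable_geometric summable_divide)
  have X: "X_proc = (\<lambda>s \<omega>. \<omega> s)" by (simp add: X_proc_def fun_eq_iff)
  define W :: "real \<Rightarrow> (nat \<Rightarrow> real) \<Rightarrow> real" where "W s \<omega> = (\<Sum>n. tanh s ^ n / cosh s * \<omega> n)" for s \<omega>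
  have W: "centred_gaussian_process gaussian_sequence UNIV W"
    unfolding W_def by (rule centred_gaussian_process_series(1)[OF f tanh_power_sums_sech])
  have WW: "(\<integral>\<omega>. W s \<omega> * W t \<omega> \<partial>gaussian_sequence) = 1 / cosh (t - s)" for s t
    unfolding W_def by (rule centred_gaussian_process_series(2)[OF f tanh_power_sums_sech])
  show "centred_gaussian_process X_law UNIV X_proc"
    unfolding X X_law_def by (rule centred_gaussian_law_of_process(1)[OF W WW])
  have "cosh (t - s) = cosh (s - t)" using cosh_minus[of "s - t"] by simp
  then show "(\<integral>\<omega>. X_proc s \<omega> * X_proc t \<omega> \<partial>X_law) = 1 / cosh (s - t)"
    unfolding X X_law_def centred_gaussian_law_of_process(2)[OF W WW] by simp
qed

section \<open>Pseudometrics with degenerate triangles\<close>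

text \<open>For nonnegative lengths this says that three points with these mutual distances embed
  isometrically in the line.\<close>

definition degenerate_triangle :: "real \<Rightarrow> real \<Rightarrow> real \<Rightarrow> bool" where
  "degenerate_triangle a b c \<longleftrightarrow> a = b + c \<or> b = a + c \<or> c = a + b"

text \<open>The numbers are the six distances among four points o, p, t, u. Placing o at 0 and p at
  \<open>op\<close>, the reals \<open>x\<close> and \<open>y\<close> are the coordinates forced on t
  and u by their distances to o and p, negative when o lies between. If these misjudge
  \<open>tu\<close>, the case analysis leaves only quadruples with equal opposite distances.\<close>

lemma linear_or_pseudolinear_quadruple:
  assumes "0 < op" "0 \<le> ot" "0 \<le> ou" "0 \<le> pt" "0 \<le> pu" "0 \<le> tu"
    and "degenerate_triangle op ot pt" "degenerate_triangle op ou pu"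
    and "degenerate_triangle ot ou tu" "degenerate_triangle pt pu tu"
    and x: "x = (if pt = op + ot then - ot else ot)" and y: "y = (if pu = op + ou then - ou else ou)"
  shows "tu = \<bar>x - y\<bar> \<or>
    (0 < ot \<and> 0 < ou \<and> op = tu \<and> ot = pu \<and> ou = pt)"
proof -
  have "(pt = op + ot \<and> x = -ot) \<or> (pt \<noteq> op + ot \<and> x = ot)" using x by auto
  moreover have "(pu = op + ou \<and> y = -ou) \<or> (pu \<noteq> op + ou \<and> y = ou)" using y by auto
  ultimately have "tu = x - y \<or> tu = y - x \<or> (0 < ot \<and> 0 < ou \<and> op = tu \<and> ot = pu \<and> ou = pt)"
    using assms(1-10) unfolding degenerate_triangle_def by argo
  then show ?thesis using \<open>0 \<le> tu\<close> by auto
qed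

text \<open>Why the exceptional space has only four points: \<open>a\<close>, \<open>b\<close>,
  \<open>c\<close>, \<open>d\<close> are the distances from a further point to the vertices of a
  quadrilateral in cyclic order, with sides \<open>p\<close>, \<open>q\<close>, \<open>p\<close>,
  \<open>q\<close> and diagonals \<open>p + q\<close>. Such a point must coincide with a
  vertex.\<close>

lemma pseudolinear_fifth_point:
  assumes "0 < p" "0 < q" "0 \<le> a" "0 \<le> b" "0 \<le> c" "0 \<le> d"
    and "degenerate_triangle a b p" "degenerate_triangle c d p"
    and "degenerate_triangle b c q" "degenerate_triangle a d q"
    and "degenerate_triangle a c (p + q)" "degenerate_triangle b d (p + q)"
  shows "a = 0 \<or> b = 0 \<or> c = 0 \<or> d = 0"
  using assms unfolding degenerate_triangle_def by argo

text \<open>Distinct points at distance 0 are allowed, because times with correlation 1 or -1 will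
  be such points. The triangle inequality follows from \<open>triple\<close> and
  nonnegativity.\<close>

locale degenerate_pseudometric =
  fixes S :: "'t set" and d :: "'t \<Rightarrow> 't \<Rightarrow> real"
  assumes d_nonneg: "s \<in> S \<Longrightarrow> t \<in> S \<Longrightarrow> 0 \<le> d s t"
    and d_sym: "s \<in> S \<Longrightarrow> t \<in> S \<Longrightarrow> d s t = d t s"
    and d_refl: "s \<in> S \<Longrightarrow> d s s = 0"
    and triple: "s \<in> S \<Longrightarrow> t \<in> S \<Longrightarrow> u \<in> S \<Longrightarrow> degenerate_triangle (d s t) (d s u) (d t u)"
begin

lemma dist_eq_of_dist_zero:
  assumes "s \<in> S" "s' \<in> S" "t \<in> S" "d s s' = 0"
  shows "d s t = d s' t"
  using triple[of s s' t] d_nonneg[of s t] d_nonneg[of s' t] assms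
  unfolding degenerate_triangle_def by auto

lemma pseudolinear_quadruple_covers:
  assumes W: "w1 \<in> S" "w2 \<in> S" "w3 \<in> S" "w4 \<in> S" and pq: "0 < p" "0 < q"
    and "d w1 w2 = p" "d w3 w4 = p" "d w2 w3 = q" "d w1 w4 = q" "d w1 w3 = p + q" "d w2 w4 = p + q"
    and e: "e \<in> S"
  shows "d e w1 = 0 \<or> d e w2 = 0 \<or> d e w3 = 0 \<or> d e w4 = 0"
  using pseudolinear_fifth_point[OF pq d_nonneg[OF e W(1)] d_nonneg[OF e W(2)] d_nonneg[OF e W(3)] d_nonneg[OF e W(4)]]
    triple[OF e W(1,2)] triple[OF e W(3,4)] triple[OF e W(2,3)] triple[OF e W(1,4)] triple[OF e W(1,3)] triple[OF e W(2,4)]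
    assms by simp

text \<open>Every point coincides with some vertex, and with only one since vertices have positive
  distances, so labelling by that vertex preserves distances. Surjectivity of the labelling is
  recorded because it later yields admissibility.\<close>

lemma pseudolinear_quadruple_imp_Y_cov:
  assumes W: "w1 \<in> S" "w2 \<in> S" "w3 \<in> S" "w4 \<in> S" and pq: "0 < p" "0 < q"
    and D: "d w1 w2 = p" "d w3 w4 = p" "d w2 w3 = q" "d w1 w4 = q" "d w1 w3 = p + q" "d w2 w4 = p + q"
  shows "\<exists>x y (\<psi> :: 't \<Rightarrow> four). 0 < x \<and> 0 < y \<and> x \<noteq> y \<and> \<psi> ` S = UNIV \<and>
    (\<forall>t\<in>S. \<forall>u\<in>S. 1 / cosh (d t u) = Y_cov x y (\<psi> t) (\<psi> u))"
proof -
  \<comment> \<open>Around the quadruple the sides are \<open>p, q, p, q\<close> and the diagonals \<open>p + q\<close>; in the labelling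
    of \<open>Y_cov\<close> the long distance must be \<open>AB\<close>, with \<open>x = p + q\<close>, \<open>y = q\<close> and \<open>x - y = p\<close>.\<close>
  define w where "w i = (case i of PA \<Rightarrow> w1 | PB \<Rightarrow> w3 | PC \<Rightarrow> w2 | PD \<Rightarrow> w4)" for i
  have wS: "w i \<in> S" for i using W by (cases i) (auto simp: w_def)
  note D' = D[unfolded d_sym[OF W(1,2)] d_sym[OF W(3,4)] d_sym[OF W(2,3)] d_sym[OF W(1,4)] d_sym[OF W(1,3)] d_sym[OF W(2,4)]]
  have wY: "1 / cosh (d (w i) (w j)) = Y_cov (p + q) q i j" for i j
    using D D' d_refl[OF W(1)] d_refl[OF W(2)] d_refl[OF W(3)] d_refl[OF W(4)]
    by (cases i; cases j) (auto simp: w_def Y_cov_def doubleton_eq_iff)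
  define \<psi> where "\<psi> e = (SOME i. d e (w i) = 0)" for e
  have \<psi>: "d e (w (\<psi> e)) = 0" if "e \<in> S" for e
  proof -
    have "d e (w PA) = 0 \<or> d e (w PC) = 0 \<or> d e (w PB) = 0 \<or> d e (w PD) = 0"
      using pseudolinear_quadruple_covers[OF W pq D that] by (simp add: w_def)
    then show ?thesis unfolding \<psi>_def by (intro someI_ex[of "\<lambda>i. d e (w i) = 0"]) blast
  qed
  have inj: "i = j" if "d (w i) (w j) = 0" for i j
    using that D D' pq by (cases i; cases j) (auto simp: w_def)
  have "\<psi> (w i) = i" for i using inj[OF \<psi>[OF wS[of i]]] by simp
  then have "\<psi> ` S = UNIV" using wS by (metis UNIV_eq_I image_eqI)
  moreover have "1 / cosh (d t u) = Y_cov (p + q) q (\<psi> t) (\<psi> u)" if "t \<in> S" "u \<in> S" for t u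
  proof -
    have "d t u = d (w (\<psi> t)) u" using that wS \<psi> by (intro dist_eq_of_dist_zero) auto
    also have "\<dots> = d u (w (\<psi> t))" using that wS d_sym by auto
    also have "\<dots> = d (w (\<psi> u)) (w (\<psi> t))" using that wS \<psi> by (intro dist_eq_of_dist_zero) auto
    also have "\<dots> = d (w (\<psi> t)) (w (\<psi> u))" using wS d_sym by auto
    finally show ?thesis using wY by simp
  qed
  ultimately show ?thesis using pq by (intro exI[of _ "p + q"] exI[of _ q] exI[of _ \<psi>]) auto
qed

text \<open>Menger's classification of metric spaces all of whose triples embed in the line.\<close>

lemma linear_or_pseudolinear:
  "(\<exists>\<psi> :: 't \<Rightarrow> real. \<forall>t\<in>S. \<forall>u\<in>S. d t u = \<bar>\<psi> t - \<psi> u\<bar>) \<or>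
   (\<exists>x y (\<psi> :: 't \<Rightarrow> four). 0 < x \<and> 0 < y \<and> x \<noteq> y \<and> \<psi> ` S = UNIV \<and>
      (\<forall>t\<in>S. \<forall>u\<in>S. 1 / cosh (d t u) = Y_cov x y (\<psi> t) (\<psi> u)))"
proof (cases "\<exists>o'\<in>S. \<exists>p\<in>S. 0 < d o' p")
  case False
  then have "d t u = \<bar>0 - 0\<bar>" if "t \<in> S" "u \<in> S" for t u
    using that d_nonneg[of t u] by force
  then show ?thesis by (intro disjI1 exI[of _ "\<lambda>_. 0"]) auto
next
  case True
  then obtain o' p where op: "o' \<in> S" "p \<in> S" "0 < d o' p" by blast
  \<comment> \<open>The point \<open>o'\<close> is the origin of the line and \<open>p\<close> fixes its orientation.\<close>
  define \<psi> where "\<psi> t = (if d p t = d o' p + d o' t then - d o' t else d o' t)" for t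
  show ?thesis
  proof (cases "\<forall>t\<in>S. \<forall>u\<in>S. d t u = \<bar>\<psi> t - \<psi> u\<bar>")
    case True
    then show ?thesis by blast
  next
    case False
    then obtain t u where tu: "t \<in> S" "u \<in> S" "d t u \<noteq> \<bar>\<psi> t - \<psi> u\<bar>" by blast
    \<comment> \<open>The pair \<open>t\<close>, \<open>u\<close> defeats the coordinates \<psi>, so
      the four points fall under the exceptional alternative.\<close>
    have q: "0 < d o' t" "0 < d o' u" "d o' p = d t u" "d o' t = d p u" "d o' u = d p t"
      using linear_or_pseudolinear_quadruple[OF op(3), of "d o' t" "d o' u" "d p t" "d p u" "d t u" "\<psi> t" "\<psi> u"]
        op tu d_nonneg triple[OF op(1,2) tu(1)] triple[OF op(1,2) tu(2)] triple[OF op(1) tu(1,2)] triple[OF op(2) tu(1,2)]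
      unfolding \<psi>_def by auto
    note sym = d_sym[OF op(1,2)] d_sym[OF op(1) tu(1)] d_sym[OF op(1) tu(2)] d_sym[OF op(2) tu(1)] d_sym[OF op(2) tu(2)] d_sym[OF tu(1,2)]
    \<comment> \<open>The three pairs of opposite points have three lengths, the longest being the
      sum of the others. That pair forms the diagonals, which fixes the cyclic order in which the
      four points are passed on.\<close>
    consider "d p t = d o' p + d o' t" | "d o' t = d o' p + d p t" | "d o' p = d o' t + d p t"
      using triple[OF op(1,2) tu(1)] unfolding degenerate_triangle_def by linarith
    then show ?thesis
    proof cases
      case 1
      then show ?thesis
        by (intro disjI2 pseudolinear_quadruple_imp_Y_cov[OF op(1,2) tu(2,1) op(3) q(1)]) (use q sym in linarith)+
    next
      case 2
      then show ?thesis
        by (intro disjI2 pseudolinear_quadruple_imp_Y_cov[OF op(1,2) tu(1,2) op(3) q(2)]) (use q sym in linarith)+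
    next
      case 3
      then show ?thesis
        by (intro disjI2 pseudolinear_quadruple_imp_Y_cov[OF op(1) tu(1) op(2) tu(2) q(1,2)]) (use q sym in linarith)+
    qed
  qed
qed

end

section \<open>Kernels conditioned at a zero\<close>

text \<open>Here \<open>e\<close> stands for \<open>\<phi> t * \<phi> u\<close>, known only up to
  sign. Since \<open>sinh a * sinh b\<close> is \<open>tanh a * tanh b\<close> times
  \<open>cosh a * cosh b\<close>, the two signs give exactly the addition theorems for
  \<open>a - b\<close> and \<open>a + b\<close>.\<close>

lemma cosh_eq_abs_diff_or_add:
  fixes a b c e :: real
  assumes "0 \<le> a" "0 \<le> b" "0 \<le> c"
    and eq: "(1 - e) * (cosh a * cosh b) = cosh c" and e: "e\<^sup>2 = (tanh a * tanh b)\<^sup>2"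
  shows "c = \<bar>a - b\<bar> \<or> c = a + b"
proof -
  have s: "sinh a * sinh b = tanh a * tanh b * (cosh a * cosh b)" by (simp add: tanh_def)
  consider "e = tanh a * tanh b" | "e = - (tanh a * tanh b)" using e by (auto simp: power2_eq_iff)
  then show ?thesis
  proof cases
    case 1
    have "cosh c = cosh (a - b)" unfolding cosh_diff s eq[symmetric] 1 by (simp add: left_diff_distrib)
    then show ?thesis using assms(3) by auto
  next
    case 2
    have "cosh c = cosh (a + b)" unfolding cosh_add s eq[symmetric] 2 by (simp add: distrib_right)
    then show ?thesis using assms(1-3) by auto
  qed
qed

text \<open>The case of one correlation class. In terms of correlations \<open>r\<close> the
  hypothesis reads \<open>r t u * (1 - \<phi> t * \<phi> u) = r t s * r u s\<close>; its moduli feed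
  the classification of degenerate pseudometrics and its signs go into \<open>a\<close>.\<close>

lemma kernel_class_structure:
  fixes K :: "'t \<Rightarrow> 't \<Rightarrow> real"
  assumes "S \<noteq> {}" and pos: "\<And>t. t \<in> S \<Longrightarrow> 0 < K t t"
    and sym: "\<And>t u. t \<in> S \<Longrightarrow> u \<in> S \<Longrightarrow> K t u = K u t"
    and nz: "\<And>t u. t \<in> S \<Longrightarrow> u \<in> S \<Longrightarrow> K t u \<noteq> 0"
    and cond: "\<And>s. s \<in> S \<Longrightarrow> \<exists>\<phi>. \<forall>t\<in>S. \<forall>u\<in>S. K t u - K t s * K u s / K s s = \<phi> t * \<phi> u * K t u"
  shows "\<exists>a. (\<forall>t\<in>S. a t \<noteq> 0) \<and>
    ((\<exists>\<psi> :: 't \<Rightarrow> real. \<forall>t\<in>S. \<forall>u\<in>S. K t u = a t * a u * (1 / cosh (\<psi> t - \<psi> u))) \<or>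
     (\<exists>x y (\<psi> :: 't \<Rightarrow> four). 0 < x \<and> 0 < y \<and> x \<noteq> y \<and> \<psi> ` S = UNIV \<and>
       (\<forall>t\<in>S. \<forall>u\<in>S. K t u = a t * a u * Y_cov x y (\<psi> t) (\<psi> u))))"
proof -
  define r where "r t u = K t u / (sqrt (K t t) * sqrt (K u u))" for t u
  have K_r: "K t u = sqrt (K t t) * sqrt (K u u) * r t u" if "t \<in> S" "u \<in> S" for t u
    using pos[OF that(1)] pos[OF that(2)] by (simp add: r_def)
  have r_nz: "r t u \<noteq> 0" if "t \<in> S" "u \<in> S" for t u
    using pos[OF that(1)] pos[OF that(2)] nz[OF that] by (simp add: r_def)
  have r_sym: "r t u = r u t" if "t \<in> S" "u \<in> S" for t u
    using sym[OF that] by (simp add: r_def mult.commute)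
  have r_diag: "r t t = 1" if "t \<in> S" for t
    using pos[OF that] by (simp add: r_def)
  have r_cond: "\<exists>\<phi>. \<forall>t\<in>S. \<forall>u\<in>S. r t u * (1 - \<phi> t * \<phi> u) = r t s * r u s" if s: "s \<in> S" for s
  proof -
    obtain \<phi> where \<phi>: "\<forall>t\<in>S. \<forall>u\<in>S. K t u - K t s * K u s / K s s = \<phi> t * \<phi> u * K t u"
      using cond[OF s] by blast
    have "r t u * (1 - \<phi> t * \<phi> u) = r t s * r u s" if t: "t \<in> S" and u: "u \<in> S" for t u
    proof -
      have "K t u - K t s * K u s / K s s = \<phi> t * \<phi> u * K t u" using \<phi> t u by blast
      then have 1: "K t u * (1 - \<phi> t * \<phi> u) = K t s * K u s / K s s" by (simp add: algebra_simps)
      have "K t s * K u s = sqrt (K t t) * sqrt (K u u) * (r t s * r u s) * (sqrt (K s s) * sqrt (K s s))"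
        using K_r[OF t s] K_r[OF u s] by (simp only: ac_simps)
      then have "K t s * K u s / K s s = sqrt (K t t) * sqrt (K u u) * (r t s * r u s)"
        using pos[OF s] by simp
      with 1 have "sqrt (K t t) * sqrt (K u u) * (r t u * (1 - \<phi> t * \<phi> u)) = sqrt (K t t) * sqrt (K u u) * (r t s * r u s)"
        by (simp add: K_r[OF t u])
      then show ?thesis using pos[OF t] pos[OF u] by simp
    qed
    then show ?thesis by blast
  qed
  \<comment> \<open>The diagonal case \<open>u = t\<close>, where the correlation is 1.\<close>
  have \<phi>_sq: "(\<phi> t)\<^sup>2 = 1 - (r t s)\<^sup>2"
    if "\<forall>t\<in>S. \<forall>u\<in>S. r t u * (1 - \<phi> t * \<phi> u) = r t s * r u s" "t \<in> S" for \<phi> t s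
    using that r_diag[OF that(2)] by (force simp: power2_eq_square)
  have \<phi>_lt: "\<bar>\<phi> t\<bar> < 1"
    if "\<forall>t\<in>S. \<forall>u\<in>S. r t u * (1 - \<phi> t * \<phi> u) = r t s * r u s" "t \<in> S" "s \<in> S" for \<phi> t s
    using \<phi>_sq[OF that(1,2)] r_nz[OF that(2,3)] by (simp add: abs_square_less_1[symmetric])
  \<comment> \<open>The bound needed for \<open>arcosh\<close> comes from the nonnegativity of
    \<open>(\<phi> t)^2\<close>, not from Cauchy-Schwarz.\<close>
  have r_le: "\<bar>r t s\<bar> \<le> 1" if "t \<in> S" "s \<in> S" for t s
  proof -
    obtain \<phi> where "\<forall>t\<in>S. \<forall>u\<in>S. r t u * (1 - \<phi> t * \<phi> u) = r t s * r u s" using r_cond[OF \<open>s \<in> S\<close>] by blast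
    from \<phi>_sq[OF this \<open>t \<in> S\<close>] have "(r t s)\<^sup>2 \<le> 1" by (metis diff_ge_0_iff_ge zero_le_power2)
    then show ?thesis by (simp add: abs_square_le_1)
  qed
  \<comment> \<open>This strict positivity, due to nonvanishing correlations, is what lets modulus
    and sign be taken separately in \<open>abs_cond\<close> and \<open>sgn_cond\<close>.\<close>
  have \<phi>\<phi>_lt: "0 < 1 - \<phi> t * \<phi> u"
    if "\<forall>t\<in>S. \<forall>u\<in>S. r t u * (1 - \<phi> t * \<phi> u) = r t s * r u s" "t \<in> S" "u \<in> S" "s \<in> S" for \<phi> t u s
  proof -
    have "\<bar>\<phi> t * \<phi> u\<bar> < 1"
      using mult_strict_mono'[OF \<phi>_lt[OF that(1,2,4)] \<phi>_lt[OF that(1,3,4)]] by (simp add: abs_mult)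
    then show ?thesis by auto
  qed
  have abs_cond: "\<exists>e. \<bar>r t u\<bar> * (1 - e) = \<bar>r t s\<bar> * \<bar>r u s\<bar> \<and> e\<^sup>2 = (1 - (r t s)\<^sup>2) * (1 - (r u s)\<^sup>2)"
    if "t \<in> S" "u \<in> S" "s \<in> S" for t u s
  proof -
    obtain \<phi> where \<phi>: "\<forall>t\<in>S. \<forall>u\<in>S. r t u * (1 - \<phi> t * \<phi> u) = r t s * r u s" using r_cond[OF \<open>s \<in> S\<close>] by blast
    then have "\<bar>r t u * (1 - \<phi> t * \<phi> u)\<bar> = \<bar>r t s * r u s\<bar>" using that by auto
    then have "\<bar>r t u\<bar> * (1 - \<phi> t * \<phi> u) = \<bar>r t s\<bar> * \<bar>r u s\<bar>"
      using \<phi>\<phi>_lt[OF \<phi> that] by (simp add: abs_mult)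
    moreover have "(\<phi> t * \<phi> u)\<^sup>2 = (1 - (r t s)\<^sup>2) * (1 - (r u s)\<^sup>2)"
      using \<phi>_sq[OF \<phi>] that by (simp add: power_mult_distrib)
    ultimately show ?thesis by blast
  qed
  have sgn_cond: "sgn (r t u) = sgn (r t s) * sgn (r u s)"
    if "t \<in> S" "u \<in> S" "s \<in> S" for t u s
  proof -
    obtain \<phi> where \<phi>: "\<forall>t\<in>S. \<forall>u\<in>S. r t u * (1 - \<phi> t * \<phi> u) = r t s * r u s" using r_cond[OF \<open>s \<in> S\<close>] by blast
    then have "sgn (r t u * (1 - \<phi> t * \<phi> u)) = sgn (r t s * r u s)" using that by auto
    then show ?thesis using \<phi>\<phi>_lt[OF \<phi> that] by (simp add: sgn_mult)
  qed
  define d where "d t u = arcosh (1 / \<bar>r t u\<bar>)" for t u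
  have r1: "1 \<le> 1 / \<bar>r t u\<bar>" if "t \<in> S" "u \<in> S" for t u
    using r_le[OF that] r_nz[OF that] by simp
  have cosh_d: "cosh (d t u) = 1 / \<bar>r t u\<bar>" and d_nonneg: "0 \<le> d t u" if "t \<in> S" "u \<in> S" for t u
    using r1[OF that] unfolding d_def by simp_all
  have tanh_d: "(tanh (d t u))\<^sup>2 = 1 - (r t u)\<^sup>2" if "t \<in> S" "u \<in> S" for t u
  proof -
    have "(tanh (d t u))\<^sup>2 = 1 - 1 / (cosh (d t u))\<^sup>2"
      by (simp add: tanh_def power_divide sinh_square_eq diff_divide_distrib)
    then show ?thesis unfolding cosh_d[OF that] by (simp add: power_divide)
  qed
  interpret degenerate_pseudometric S d
  proof
    fix s t u assume S: "s \<in> S" "t \<in> S" "u \<in> S"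
    show "0 \<le> d s t" using d_nonneg S by simp
    show "d s t = d t s" using r_sym S by (simp add: d_def)
    show "d s s = 0" using r_diag S by (simp add: d_def)
    obtain e where e: "\<bar>r t u\<bar> * (1 - e) = \<bar>r t s\<bar> * \<bar>r u s\<bar>" "e\<^sup>2 = (1 - (r t s)\<^sup>2) * (1 - (r u s)\<^sup>2)"
      using abs_cond[OF S(2,3,1)] by blast
    have "d t u = \<bar>d t s - d u s\<bar> \<or> d t u = d t s + d u s"
    proof (rule cosh_eq_abs_diff_or_add)
      show "(1 - e) * (cosh (d t s) * cosh (d u s)) = cosh (d t u)"
        using S e(1) r_nz by (simp add: cosh_d field_simps)
      show "e\<^sup>2 = (tanh (d t s) * tanh (d u s))\<^sup>2"
        using S e(2) by (simp add: power_mult_distrib tanh_d)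
    qed (use S d_nonneg in auto)
    moreover have "d t s = d s t" "d u s = d s u" using r_sym S by (simp_all add: d_def)
    ultimately show "degenerate_triangle (d s t) (d s u) (d t u)"
      unfolding degenerate_triangle_def by auto
  qed
  obtain t0 where t0: "t0 \<in> S" using \<open>S \<noteq> {}\<close> by blast
  \<comment> \<open>By \<open>sgn_cond\<close> with the base point \<open>t0\<close>, the sign of
    \<open>r t u\<close> is the product of the signs of \<open>r t t0\<close> and
    \<open>r u t0\<close>, so each time can carry its own sign.\<close>
  define a where "a t = sgn (r t t0) * sqrt (K t t)" for t
  have a_nz: "\<forall>t\<in>S. a t \<noteq> 0"
  proof
    fix t assume "t \<in> S"
    then show "a t \<noteq> 0" using pos[of t] r_nz[OF _ t0] by (auto simp: a_def sgn_zero_iff)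
  qed
  have K_a: "K t u = a t * a u * (1 / cosh (d t u))" if "t \<in> S" "u \<in> S" for t u
  proof -
    have "r t u = sgn (r t u) * \<bar>r t u\<bar>" by (simp add: sgn_mult_abs)
    then have "r t u = sgn (r t t0) * sgn (r u t0) * \<bar>r t u\<bar>" unfolding sgn_cond[OF that t0] .
    then show ?thesis using K_r[OF that] cosh_d[OF that] by (simp add: a_def)
  qed
  from linear_or_pseudolinear show ?thesis
  proof (elim disjE exE conjE)
    fix \<psi> :: "'t \<Rightarrow> real" assume "\<forall>t\<in>S. \<forall>u\<in>S. d t u = \<bar>\<psi> t - \<psi> u\<bar>"
    then have "\<forall>t\<in>S. \<forall>u\<in>S. K t u = a t * a u * (1 / cosh (\<psi> t - \<psi> u))" using K_a by simp
    then show ?thesis using a_nz by blast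
  next
    fix x y and \<psi> :: "'t \<Rightarrow> four"
    assume xy: "0 < x" "0 < y" "x \<noteq> y" "\<psi> ` S = UNIV" and "\<forall>t\<in>S. \<forall>u\<in>S. 1 / cosh (d t u) = Y_cov x y (\<psi> t) (\<psi> u)"
    then have "\<forall>t\<in>S. \<forall>u\<in>S. K t u = a t * a u * Y_cov x y (\<psi> t) (\<psi> u)" using K_a by simp
    then show ?thesis using a_nz xy by blast
  qed
qed

text \<open>The classes are those of the relation of being correlated. Nonvanishing of
  \<open>a\<close> and surjectivity of \<psi> accompany the four-point alternative, where dividing
  by \<open>a\<close> must later recover a process on all four vertices.\<close>

lemma kernel_decomposition:
  fixes K :: "'t \<Rightarrow> 't \<Rightarrow> real"
  assumes nonneg: "\<And>t. t \<in> T \<Longrightarrow> 0 \<le> K t t"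
    and sym: "\<And>t u. t \<in> T \<Longrightarrow> u \<in> T \<Longrightarrow> K t u = K u t"
    and zero: "\<And>t u. t \<in> T \<Longrightarrow> u \<in> T \<Longrightarrow> K t t = 0 \<Longrightarrow> K t u = 0"
    and cond: "\<And>s. s \<in> T \<Longrightarrow> 0 < K s s \<Longrightarrow> \<exists>\<phi>. \<forall>t\<in>T. \<forall>u\<in>T. K t u - K t s * K u s / K s s = \<phi> t * \<phi> u * K t u"
  shows "\<exists>P a. partition_on T P \<and>
    (\<forall>S\<in>P. \<forall>S'\<in>P. S \<noteq> S' \<longrightarrow> (\<forall>s\<in>S. \<forall>t\<in>S'. K s t = 0)) \<and>
    (\<forall>S\<in>P. (\<exists>\<psi> :: 't \<Rightarrow> real. \<forall>t\<in>S. \<forall>u\<in>S. K t u = a t * a u * (1 / cosh (\<psi> t - \<psi> u))) \<or>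
     (\<exists>x y (\<psi> :: 't \<Rightarrow> four). 0 < x \<and> 0 < y \<and> x \<noteq> y \<and> \<psi> ` S = UNIV \<and> (\<forall>t\<in>S. a t \<noteq> 0) \<and>
       (\<forall>t\<in>S. \<forall>u\<in>S. K t u = a t * a u * Y_cov x y (\<psi> t) (\<psi> u))))"
proof -
  \<comment> \<open>The disjunct \<open>t = u\<close> keeps the relation reflexive at times of zero
    variance.\<close>
  define R where "R = {(t, u) \<in> T \<times> T. t = u \<or> K t u \<noteq> 0}"
  have trans: "K t u \<noteq> 0" if T: "t \<in> T" "s \<in> T" "u \<in> T" and nz: "K t s \<noteq> 0" "K s u \<noteq> 0" for t s u
  proof
    assume "K t u = 0"
    have "K s s \<noteq> 0" using zero[OF T(2,3)] nz by auto
    then have pos: "0 < K s s" using nonneg[OF T(2)] by simp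
    then obtain \<phi> where "\<forall>t\<in>T. \<forall>u\<in>T. K t u - K t s * K u s / K s s = \<phi> t * \<phi> u * K t u"
      using cond[OF T(2)] by blast
    \<comment> \<open>If \<open>K t u\<close> vanished, conditioning at the intermediate time
      \<open>s\<close> would leave \<open>K t s * K u s = 0\<close>, contrary to
      \<open>nz\<close>.\<close>
    then have "K t u - K t s * K u s / K s s = \<phi> t * \<phi> u * K t u" using T by blast
    then show False using \<open>K t u = 0\<close> pos nz sym[OF T(2,3)] by simp
  qed
  have equiv: "equiv T R"
  proof (rule equivI)
    show "refl_on T R" by (auto simp: refl_on_def R_def)
    show "sym R" using sym by (auto simp: sym_def R_def)
    show "trans R" using trans by (auto simp: trans_def R_def)
    show "R \<subseteq> T \<times> T" by (auto simp: R_def)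
  qed
  define P where "P = T // R"
  have P: "partition_on T P" unfolding P_def by (rule partition_on_quotient[OF equiv])
  have P_sub: "S \<subseteq> T" "S \<noteq> {}" if "S \<in> P" for S
    using that P by (auto simp: partition_on_def)
  have P_rel: "(t, u) \<in> R" if "S \<in> P" "t \<in> S" "u \<in> S" for S t u
    using that unfolding P_def by (metis equiv quotient_eq_iff)
  have orth: "K s t = 0" if "S \<in> P" "S' \<in> P" "S \<noteq> S'" "s \<in> S" "t \<in> S'" for S S' s t
  proof (rule ccontr)
    assume "K s t \<noteq> 0"
    then have "(s, t) \<in> R" using that P_sub by (auto simp: R_def)
    then show False using that quotient_eq_iff[OF equiv, of S S' s t] by (simp add: P_def)
  qed
  let ?Q = "\<lambda>S a. (\<exists>\<psi> :: 't \<Rightarrow> real. \<forall>t\<in>S. \<forall>u\<in>S. K t u = a t * a u * (1 / cosh (\<psi> t - \<psi> u))) \<or>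
     (\<exists>x y (\<psi> :: 't \<Rightarrow> four). 0 < x \<and> 0 < y \<and> x \<noteq> y \<and> \<psi> ` S = UNIV \<and> (\<forall>t\<in>S. a t \<noteq> 0) \<and>
       (\<forall>t\<in>S. \<forall>u\<in>S. K t u = a t * a u * Y_cov x y (\<psi> t) (\<psi> u)))"
  have "\<exists>a. ?Q S a" if S: "S \<in> P" for S
  proof (cases "\<exists>t\<in>S. K t t = 0")
    case True
    then obtain t where t: "t \<in> S" "K t t = 0" by blast
    \<comment> \<open>A time of zero variance is correlated with nothing, so its class is a
      singleton, and \<open>a = 0\<close> makes the linear alternative trivial.\<close>
    then have "S = {t}" using P_rel[OF S t(1)] zero P_sub[OF S] by (auto simp: R_def)
    then show ?thesis using t by (intro exI[of _ "\<lambda>_. 0"] disjI1) simp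
  next
    case False
    have ST: "S \<subseteq> T" by (rule P_sub(1)[OF S])
    have pos: "0 < K t t" if "t \<in> S" for t
      using False that ST nonneg[of t] by (auto simp: less_le)
    have nz: "K t u \<noteq> 0" if "t \<in> S" "u \<in> S" for t u
      using P_rel[OF S that] pos[OF that(1)] by (auto simp: R_def)
    have c: "\<exists>\<phi>. \<forall>t\<in>S. \<forall>u\<in>S. K t u - K t s * K u s / K s s = \<phi> t * \<phi> u * K t u" if "s \<in> S" for s
      using cond[of s] pos[OF that] that ST by (meson subsetD)
    have sym': "K t u = K u t" if "t \<in> S" "u \<in> S" for t u using sym that ST by auto
    from kernel_class_structure[OF P_sub(2)[OF S] pos sym' nz c] show ?thesis by blast
  qed
  then obtain A where A: "\<And>S. S \<in> P \<Longrightarrow> ?Q S (A S)" by metis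
  \<comment> \<open>The amplitudes found class by class are glued: each time uses the function
    belonging to its own class.\<close>
  define a where "a t = A (R `` {t}) t" for t
  have aA: "a t = A S t" if "S \<in> P" "t \<in> S" for S t
  proof -
    have "R `` {t} = S" using that equiv unfolding P_def
      by (metis P_def P_sub(1) Image_singleton_iff equiv_class_eq_iff quotientE subsetD)
    then show ?thesis by (simp add: a_def)
  qed
  have Q: "?Q S a" if "S \<in> P" for S
    using A[OF that] aA[OF that] by simp
  show ?thesis
  proof (intro exI[of _ P] exI[of _ a] conjI ballI impI P)
    show "K s t = 0" if "S \<in> P" "S' \<in> P" "S \<noteq> S'" "s \<in> S" "t \<in> S'" for S S' s t
      using that by (rule orth)
    show "?Q S a" if "S \<in> P" for S
      using that by (rule Q)
  qed
qed

section \<open>The decomposition\<close>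

lemma same_fdd_covariance:
  assumes "same_fdd T M U N V" "t \<in> T" "u \<in> T"
    and U: "U t \<in> borel_measurable M" "U u \<in> borel_measurable M"
    and V: "V t \<in> borel_measurable N" "V u \<in> borel_measurable N"
  shows "(\<integral>\<omega>. U t \<omega> * U u \<omega> \<partial>M) = (\<integral>\<omega>. V t \<omega> * V u \<omega> \<partial>N)"
proof -
  let ?J = "{t, u}"
  have *: "(\<integral>x. x t * x u \<partial>distr K (PiM ?J (\<lambda>_. borel)) (\<lambda>\<omega>. \<lambda>t\<in>?J. W t \<omega>)) = (\<integral>\<omega>. W t \<omega> * W u \<omega> \<partial>K)"
    if "W t \<in> borel_measurable K" "W u \<in> borel_measurable K" for K :: "'k measure" and W :: "'a \<Rightarrow> 'k \<Rightarrow> real"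
  proof -
    have "(\<lambda>\<omega>. \<lambda>t\<in>?J. W t \<omega>) \<in> K \<rightarrow>\<^sub>M PiM ?J (\<lambda>_. borel)"
      using that by (intro measurable_restrict) auto
    moreover have "(\<lambda>x. x t * x u) \<in> borel_measurable (PiM ?J (\<lambda>_. borel :: real measure))"
      by measurable
    ultimately show ?thesis by (simp add: integral_distr)
  qed
  have "distr M (PiM ?J (\<lambda>_. borel)) (\<lambda>\<omega>. \<lambda>t\<in>?J. U t \<omega>) = distr N (PiM ?J (\<lambda>_. borel)) (\<lambda>\<omega>. \<lambda>t\<in>?J. V t \<omega>)"
    using assms(1-3) unfolding same_fdd_def by simp
  then show ?thesis using *[of U M] *[of V N] U V by simp
qed

lemma centred_gaussian_process_zero_variance:
  assumes Z: "centred_gaussian_process M T Z" and T: "t \<in> T" "u \<in> T"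
    and "(\<integral>\<omega>. Z t \<omega> * Z t \<omega> \<partial>M) = 0"
  shows "(\<integral>\<omega>. Z t \<omega> * Z u \<omega> \<partial>M) = 0"
proof -
  note D = centred_gaussian_processD[OF Z]
  have [measurable]: "Z t \<in> borel_measurable M" "Z u \<in> borel_measurable M" using D(2) T by auto
  have "AE \<omega> in M. Z t \<omega> * Z t \<omega> = 0"
    using integral_nonneg_eq_0_iff_AE[OF D(5)[OF T(1) T(1)]] assms(4) by simp
  then have "AE \<omega> in M. Z t \<omega> * Z u \<omega> = 0" by auto
  then have "(\<integral>\<omega>. Z t \<omega> * Z u \<omega> \<partial>M) = (\<integral>\<omega>. 0 \<partial>M)" by (intro integral_cong_AE) auto
  then show ?thesis by simp
qed

text \<open>Conditioning at \<open>s\<close> replaces \<open>Z\<close> by its regression residual,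
  whose covariance is the Schur complement on the left. Equal two-point laws give equal second
  moments.\<close>

lemma covariance_of_conditioned_at_zero:
  fixes Z :: "'t \<Rightarrow> 'w \<Rightarrow> real"
  assumes Z: "centred_gaussian_process M T Z"
  defines "K \<equiv> \<lambda>s t. \<integral>\<omega>. Z s \<omega> * Z t \<omega> \<partial>M"
  assumes s: "s \<in> T" "0 < K s s"
    and fdd: "same_fdd T M (conditioned_at_zero M Z s) M (\<lambda>t \<omega>. \<phi> t * Z t \<omega>)"
    and t: "t \<in> T" and u: "u \<in> T"
  shows "K t u - K t s * K u s / K s s = \<phi> t * \<phi> u * K t u"
proof -
  note D = centred_gaussian_processD[OF Z]
  have cov: "cov M (Z a) (Z b) = K a b" if "a \<in> T" "b \<in> T" for a b
    using D(4) that by (simp add: cov_def K_def)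
  define W where "W t \<omega> = Z t \<omega> - K t s / K s s * Z s \<omega>" for t \<omega>
  have W: "conditioned_at_zero M Z s a = W a" if "a \<in> T" for a
    using s cov that by (simp add: conditioned_at_zero_def W_def fun_eq_iff)
  have mW: "W a \<in> borel_measurable M" if "a \<in> T" for a
    unfolding W_def using D(2)[OF that] D(2)[OF s(1)] by measurable
  have mZ: "(\<lambda>\<omega>. \<phi> a * Z a \<omega>) \<in> borel_measurable M" if "a \<in> T" for a
    using D(2)[OF that] by measurable
  have "(\<integral>\<omega>. W t \<omega> * W u \<omega> \<partial>M) = (\<integral>\<omega>. (\<phi> t * Z t \<omega>) * (\<phi> u * Z u \<omega>) \<partial>M)"
    using same_fdd_covariance[OF fdd t u] W[OF t] W[OF u] mW[OF t] mW[OF u] mZ[OF t] mZ[OF u] by simp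
  also have "\<dots> = (\<integral>\<omega>. \<phi> t * \<phi> u * (Z t \<omega> * Z u \<omega>) \<partial>M)" by (simp add: ac_simps)
  also have "\<dots> = \<phi> t * \<phi> u * K t u" by (simp add: K_def)
  finally have 1: "(\<integral>\<omega>. W t \<omega> * W u \<omega> \<partial>M) = \<phi> t * \<phi> u * K t u" .
  define c where "c = K t s / K s s"
  define e where "e = K u s / K s s"
  have "(\<integral>\<omega>. W t \<omega> * W u \<omega> \<partial>M) =
    (\<integral>\<omega>. Z t \<omega> * Z u \<omega> - e * (Z t \<omega> * Z s \<omega>) - c * (Z u \<omega> * Z s \<omega>) + c * e * (Z s \<omega> * Z s \<omega>) \<partial>M)"
    by (simp add: W_def c_def[symmetric] e_def[symmetric] algebra_simps)
  also have "\<dots> = K t u - e * K t s - c * K u s + c * e * K s s"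
    using D(5)[OF t u] D(5)[OF t s(1)] D(5)[OF u s(1)] D(5)[OF s(1) s(1)] by (simp add: K_def)
  also have "\<dots> = K t u - K t s * K u s / K s s"
    using s(2) by (simp add: c_def e_def)
  finally show ?thesis using 1 by simp
qed

section \<open>Identification of the laws on the classes\<close>

lemma same_fdd_X_law:
  assumes Z: "centred_gaussian_process M S Z"
    and K: "\<And>t u. t \<in> S \<Longrightarrow> u \<in> S \<Longrightarrow> (\<integral>\<omega>. Z t \<omega> * Z u \<omega> \<partial>M) = a t * a u * (1 / cosh (\<psi> t - \<psi> u))"
  shows "same_fdd S M Z X_law (\<lambda>t \<omega>. a t * X_proc (\<psi> t) \<omega>)"
proof (rule same_fdd_of_covariance[OF Z])
  show "centred_gaussian_process X_law S (\<lambda>t \<omega>. a t * X_proc (\<psi> t) \<omega>)"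
    by (rule centred_gaussian_process_scale_reindex[OF X_law(1)]) simp
  fix t u assume "t \<in> S" "u \<in> S"
  then show "(\<integral>\<omega>. Z t \<omega> * Z u \<omega> \<partial>M) = (\<integral>\<omega>. a t * X_proc (\<psi> t) \<omega> * (a u * X_proc (\<psi> u) \<omega>) \<partial>X_law)"
    using K[of t u] X_law(2)[of "\<psi> t" "\<psi> u"] by (simp add: mult.assoc mult.left_commute[of _ "a u"])
qed

text \<open>Admissibility is deduced, not assumed: picking one time over each vertex and dividing by
  \<open>a\<close> there gives a Gaussian process with kernel \<open>Y_cov x y\<close>. Hence the
  matrix is positive semi-definite, and the same process is the witness that
  \<open>Y_law x y\<close> needs.\<close>

lemma same_fdd_Y_law:
  assumes Z: "centred_gaussian_process M S Z" and xy: "0 < x" "0 < y" "x \<noteq> y"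
    and \<psi>: "\<psi> ` S = UNIV" and a: "\<And>t. t \<in> S \<Longrightarrow> a t \<noteq> 0"
    and K: "\<And>t u. t \<in> S \<Longrightarrow> u \<in> S \<Longrightarrow> (\<integral>\<omega>. Z t \<omega> * Z u \<omega> \<partial>M) = a t * a u * Y_cov x y (\<psi> t) (\<psi> u)"
  shows "admissible x y" "same_fdd S M Z (Y_law x y) (\<lambda>t \<omega>. a t * Y_proc (\<psi> t) \<omega>)"
proof -
  define w where "w = inv_into S \<psi>"
  have w: "w i \<in> S" "\<psi> (w i) = i" for i
    using \<psi> by (auto simp: w_def inv_into_into f_inv_into_f)
  define Y where "Y i \<omega> = 1 / a (w i) * Z (w i) \<omega>" for i \<omega>
  have Y: "centred_gaussian_process M UNIV Y"
    unfolding Y_def by (rule centred_gaussian_process_scale_reindex[OF Z]) (use w in auto)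
  have YY: "(\<integral>\<omega>. Y i \<omega> * Y j \<omega> \<partial>M) = Y_cov x y i j" for i j
    using K[OF w(1) w(1), of i j] a[OF w(1), of i] a[OF w(1), of j] by (simp add: Y_def w(2) field_simps)
  show "admissible x y"
    unfolding admissible_def pos_semidef_def
  proof (intro conjI xy allI)
    show "Y_cov x y i j = Y_cov x y j i" for i j
      unfolding YY[symmetric] by (simp add: mult.commute)
    fix c :: "four \<Rightarrow> real"
    note D = centred_gaussian_processD[OF Y]
    \<comment> \<open>The quadratic form of the kernel is the second moment of a linear combination
      of \<open>Y\<close>.\<close>
    have "0 \<le> (\<integral>\<omega>. (\<Sum>i\<in>UNIV. c i * Y i \<omega>) * (\<Sum>j\<in>UNIV. c j * Y j \<omega>) \<partial>M)"
      by (intro integral_nonneg_AE) simp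
    also have "\<dots> = (\<integral>\<omega>. (\<Sum>i\<in>UNIV. \<Sum>j\<in>UNIV. c i * c j * (Y i \<omega> * Y j \<omega>)) \<partial>M)"
      by (simp add: sum_product ac_simps)
    also have "\<dots> = (\<Sum>i\<in>UNIV. \<Sum>j\<in>UNIV. c i * c j * Y_cov x y i j)"
      by (simp add: Bochner_Integration.integral_sum Bochner_Integration.integrable_sum D(5) YY)
    finally show "0 \<le> (\<Sum>i\<in>UNIV. \<Sum>j\<in>UNIV. c i * Y_cov x y i j * c j)"
      by (simp add: ac_simps)
  qed
  have Y_proc: "Y_proc = (\<lambda>s \<omega>. \<omega> s)" by (simp add: Y_proc_def fun_eq_iff)
  have L: "centred_gaussian_process (Y_law x y) UNIV Y_proc"
    unfolding Y_proc Y_law_def by (rule centred_gaussian_law_of_process(1)[OF Y YY])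
  have LL: "(\<integral>\<omega>. Y_proc i \<omega> * Y_proc j \<omega> \<partial>Y_law x y) = Y_cov x y i j" for i j
    unfolding Y_proc Y_law_def by (rule centred_gaussian_law_of_process(2)[OF Y YY])
  show "same_fdd S M Z (Y_law x y) (\<lambda>t \<omega>. a t * Y_proc (\<psi> t) \<omega>)"
  proof (rule same_fdd_of_covariance[OF Z])
    show "centred_gaussian_process (Y_law x y) S (\<lambda>t \<omega>. a t * Y_proc (\<psi> t) \<omega>)"
      by (rule centred_gaussian_process_scale_reindex[OF L]) simp
    fix t u assume "t \<in> S" "u \<in> S"
    then show "(\<integral>\<omega>. Z t \<omega> * Z u \<omega> \<partial>M) = (\<integral>\<omega>. a t * Y_proc (\<psi> t) \<omega> * (a u * Y_proc (\<psi> u) \<omega>) \<partial>Y_law x y)"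
      using K[of t u] LL[of "\<psi> t" "\<psi> u"] by (simp add: mult.assoc mult.left_commute[of _ "a u"])
  qed
qed

theorem corollary1p8:
  fixes M :: "'w measure" and T :: "'t set" and Z :: "'t \<Rightarrow> 'w \<Rightarrow> real"
  assumes "centred_gaussian_process M T Z"
    and "\<forall>s0\<in>T. \<exists>\<phi> :: 't \<Rightarrow> real.
           same_fdd T M (conditioned_at_zero M Z s0) M (\<lambda>t \<omega>. \<phi> t * Z t \<omega>)"
  shows "\<exists>(P :: 't set set) (a :: 't \<Rightarrow> real).
    partition_on T P \<and>
    (\<forall>S\<in>P. \<forall>S'\<in>P. S \<noteq> S' \<longrightarrow>
       prob_space.indep_var M
         (PiM S (\<lambda>_. borel)) (\<lambda>\<omega>. \<lambda>t\<in>S. Z t \<omega>)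
         (PiM S' (\<lambda>_. borel)) (\<lambda>\<omega>. \<lambda>t\<in>S'. Z t \<omega>)) \<and>
    (\<forall>S\<in>P.
       (\<exists>\<psi> :: 't \<Rightarrow> real. same_fdd S M Z X_law (\<lambda>t \<omega>. a t * X_proc (\<psi> t) \<omega>)) \<or>
       (\<exists>x y. admissible x y \<and>
          (\<exists>\<psi> :: 't \<Rightarrow> four. same_fdd S M Z (Y_law x y) (\<lambda>t \<omega>. a t * Y_proc (\<psi> t) \<omega>))))"
proof -
  note Z = assms(1)
  define K where "K s t = (\<integral>\<omega>. Z s \<omega> * Z t \<omega> \<partial>M)" for s t
  have "\<exists>P a. partition_on T P \<and>
    (\<forall>S\<in>P. \<forall>S'\<in>P. S \<noteq> S' \<longrightarrow> (\<forall>s\<in>S. \<forall>t\<in>S'. K s t = 0)) \<and>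
    (\<forall>S\<in>P. (\<exists>\<psi> :: 't \<Rightarrow> real. \<forall>t\<in>S. \<forall>u\<in>S. K t u = a t * a u * (1 / cosh (\<psi> t - \<psi> u))) \<or>
     (\<exists>x y (\<psi> :: 't \<Rightarrow> four). 0 < x \<and> 0 < y \<and> x \<noteq> y \<and> \<psi> ` S = UNIV \<and> (\<forall>t\<in>S. a t \<noteq> 0) \<and>
       (\<forall>t\<in>S. \<forall>u\<in>S. K t u = a t * a u * Y_cov x y (\<psi> t) (\<psi> u))))"
  proof (rule kernel_decomposition)
    show "0 \<le> K t t" for t unfolding K_def by (intro integral_nonneg_AE) simp
    show "K t u = K u t" for t u unfolding K_def by (simp add: mult.commute)
    show "K t u = 0" if "t \<in> T" "u \<in> T" "K t t = 0" for t u
      using centred_gaussian_process_zero_variance[OF Z that(1,2)] that(3) by (simp add: K_def)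
    show "\<exists>\<phi>. \<forall>t\<in>T. \<forall>u\<in>T. K t u - K t s * K u s / K s s = \<phi> t * \<phi> u * K t u" if "s \<in> T" "0 < K s s" for s
    proof -
      from bspec[OF assms(2) that(1)] obtain \<phi>
        where "same_fdd T M (conditioned_at_zero M Z s) M (\<lambda>t \<omega>. \<phi> t * Z t \<omega>)" by (rule exE)
      from covariance_of_conditioned_at_zero[OF Z that[unfolded K_def] this] show ?thesis
        unfolding K_def by (intro exI[of _ \<phi>] ballI)
    qed
  qed
  then obtain P a where P: "partition_on T P"
    and orth: "\<forall>S\<in>P. \<forall>S'\<in>P. S \<noteq> S' \<longrightarrow> (\<forall>s\<in>S. \<forall>t\<in>S'. K s t = 0)"
    and shape: "\<forall>S\<in>P. (\<exists>\<psi> :: 't \<Rightarrow> real. \<forall>t\<in>S. \<forall>u\<in>S. K t u = a t * a u * (1 / cosh (\<psi> t - \<psi> u))) \<or>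
     (\<exists>x y (\<psi> :: 't \<Rightarrow> four). 0 < x \<and> 0 < y \<and> x \<noteq> y \<and> \<psi> ` S = UNIV \<and> (\<forall>t\<in>S. a t \<noteq> 0) \<and>
       (\<forall>t\<in>S. \<forall>u\<in>S. K t u = a t * a u * Y_cov x y (\<psi> t) (\<psi> u)))"
    by (elim exE conjE) (rule that)
  have sub: "S \<subseteq> T" if "S \<in> P" for S using P that by (auto simp: partition_on_def)
  show ?thesis
  proof (intro exI[of _ P] exI[of _ a] conjI ballI impI P)
    fix S S' assume S: "S \<in> P" "S' \<in> P" "S \<noteq> S'"
    have disj: "S \<inter> S' = {}" using P S by (auto simp: partition_on_def disjoint_def)
    show "prob_space.indep_var M (PiM S (\<lambda>_. borel)) (\<lambda>\<omega>. \<lambda>t\<in>S. Z t \<omega>)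
         (PiM S' (\<lambda>_. borel)) (\<lambda>\<omega>. \<lambda>t\<in>S'. Z t \<omega>)"
      using orth S by (intro indep_var_of_uncorrelated[OF Z sub[OF S(1)] sub[OF S(2)] disj]) (simp add: K_def)
  next
    fix S assume S: "S \<in> P"
    have ZS: "centred_gaussian_process M S Z" by (rule centred_gaussian_process_subset[OF Z sub[OF S]])
    from shape S have "(\<exists>\<psi> :: 't \<Rightarrow> real. \<forall>t\<in>S. \<forall>u\<in>S. K t u = a t * a u * (1 / cosh (\<psi> t - \<psi> u))) \<or>
     (\<exists>x y (\<psi> :: 't \<Rightarrow> four). 0 < x \<and> 0 < y \<and> x \<noteq> y \<and> \<psi> ` S = UNIV \<and> (\<forall>t\<in>S. a t \<noteq> 0) \<and>
       (\<forall>t\<in>S. \<forall>u\<in>S. K t u = a t * a u * Y_cov x y (\<psi> t) (\<psi> u)))" by (rule bspec)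
    then show "(\<exists>\<psi> :: 't \<Rightarrow> real. same_fdd S M Z X_law (\<lambda>t \<omega>. a t * X_proc (\<psi> t) \<omega>)) \<or>
       (\<exists>x y. admissible x y \<and>
          (\<exists>\<psi> :: 't \<Rightarrow> four. same_fdd S M Z (Y_law x y) (\<lambda>t \<omega>. a t * Y_proc (\<psi> t) \<omega>)))"
    proof (elim disjE exE conjE)
      fix \<psi> :: "'t \<Rightarrow> real" assume "\<forall>t\<in>S. \<forall>u\<in>S. K t u = a t * a u * (1 / cosh (\<psi> t - \<psi> u))"
      then have "same_fdd S M Z X_law (\<lambda>t \<omega>. a t * X_proc (\<psi> t) \<omega>)"
        by (intro same_fdd_X_law[OF ZS]) (simp add: K_def)
      then show ?thesis by blast
    next
      fix x y and \<psi> :: "'t \<Rightarrow> four"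
      assume xy: "0 < x" "0 < y" "x \<noteq> y" and \<psi>: "\<psi> ` S = UNIV" and a: "\<forall>t\<in>S. a t \<noteq> 0"
        and "\<forall>t\<in>S. \<forall>u\<in>S. K t u = a t * a u * Y_cov x y (\<psi> t) (\<psi> u)"
      then have "(\<integral>\<omega>. Z t \<omega> * Z u \<omega> \<partial>M) = a t * a u * Y_cov x y (\<psi> t) (\<psi> u)" if "t \<in> S" "u \<in> S" for t u
        using that by (simp add: K_def)
      from same_fdd_Y_law[OF ZS xy \<psi> _ this] a show ?thesis by blast
    qed
  qed
qed

end
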